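(* For every positive integer $n$, there exists a subnormal composition operator $C$ in an $L^2$-space over a $\sigma$-finite measure space such that $C^n$ is densely defined and $\mathcal D(C^{n+1})=\{0\}$.
   Context: Let $(X,\mathscr A,\mu)$ be a $\sigma$-finite (positive) measure space and let $\phi:X\to X$ be a transformation such that $\phi^{-1}(\Delta)\in\mathscr A$ for every $\Delta\in\mathscr A$, and $\mu(\phi^{-1}(\Delta))=0$ for every $\Delta\in\mathscr A$ with $\mu(\Delta)=0$. The operator $C$ in (complex) $L^2(\mu)$ given by $\mathcal D(C)=\{g\in L^2(\mu): g\circ\phi\in L^2(\mu)\}$ and $Cf=f\circ\phi$ for $f\in\mathcal D(C)$ is well-defined and is called a composition operator. Operators in Hilbert spaces are linear and possibly unbounded; $\mathcal D(A)$ is the domain of $A$, and powers $A^n$ have their natural (maximal) domains: $\mathcal D(A^{k+1})=\{h\in\mathcal D(A^k):A^kh\in\mathcal D(A)\}$. A closed densely defined operator $N$ is normal if $NN^*=N^*N$. A densely defined operator $A$ in a complex Hilbert space $\mathcal H$ is subnormal if there exist a complex Hilbert space $\mathcal K\supseteq\mathcal H$ (isometric embedding) and a normal operator $N$ in $\mathcal K$ such that $\mathcal D(A)\subseteq\mathcal D(N)$ and $Ah=Nh$ for all $h\in\mathcal D(A)$. *)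

theory Defs
  imports "HOL-Analysis.Analysis"
begin

record 'h cspace =
  vecs :: "'h set"
  vzero :: 'h
  vadd :: "'h \<Rightarrow> 'h \<Rightarrow> 'h"
  vscale :: "complex \<Rightarrow> 'h \<Rightarrow> 'h"
  cinner :: "'h \<Rightarrow> 'h \<Rightarrow> complex"

definition vnorm :: "'h cspace \<Rightarrow> 'h \<Rightarrow> real" where
  "vnorm H x = sqrt (Re (cinner H x x))"

text \<open>The locale \<^locale>\<open>Metric_space\<close> requires symmetry and nonnegativity of the distance
  also outside the carrier.\<close>

definition vdist :: "'h cspace \<Rightarrow> 'h \<Rightarrow> 'h \<Rightarrow> real" where
  "vdist H x y = (if x \<in> vecs H \<and> y \<in> vecs H then vnorm H (vadd H x (vscale H (-1) y)) else 0)"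

definition vtopology :: "'h cspace \<Rightarrow> 'h topology" where
  "vtopology H = Metric_space.mtopology (vecs H) (vdist H)"

text \<open>The inner product is linear in its first argument.\<close>

locale complex_inner_space =
  fixes H :: "'h cspace"
  assumes zero_in: "vzero H \<in> vecs H"
    and add_in: "\<lbrakk>x \<in> vecs H; y \<in> vecs H\<rbrakk> \<Longrightarrow> vadd H x y \<in> vecs H"
    and scale_in: "x \<in> vecs H \<Longrightarrow> vscale H a x \<in> vecs H"
    and add_assoc: "\<lbrakk>x \<in> vecs H; y \<in> vecs H; z \<in> vecs H\<rbrakk> \<Longrightarrow>
          vadd H (vadd H x y) z = vadd H x (vadd H y z)"
    and add_commute: "\<lbrakk>x \<in> vecs H; y \<in> vecs H\<rbrakk> \<Longrightarrow> vadd H x y = vadd H y x"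
    and add_zero: "x \<in> vecs H \<Longrightarrow> vadd H x (vzero H) = x"
    and add_inverse: "x \<in> vecs H \<Longrightarrow> vadd H x (vscale H (-1) x) = vzero H"
    and scale_add_right: "\<lbrakk>x \<in> vecs H; y \<in> vecs H\<rbrakk> \<Longrightarrow>
          vscale H a (vadd H x y) = vadd H (vscale H a x) (vscale H a y)"
    and scale_add_left: "x \<in> vecs H \<Longrightarrow>
          vscale H (a + b) x = vadd H (vscale H a x) (vscale H b x)"
    and scale_scale: "x \<in> vecs H \<Longrightarrow> vscale H a (vscale H b x) = vscale H (a * b) x"
    and scale_one: "x \<in> vecs H \<Longrightarrow> vscale H 1 x = x"
    and inner_commute: "\<lbrakk>x \<in> vecs H; y \<in> vecs H\<rbrakk> \<Longrightarrow> cinner H y x = cnj (cinner H x y)"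
    and inner_add_left: "\<lbrakk>x \<in> vecs H; y \<in> vecs H; z \<in> vecs H\<rbrakk> \<Longrightarrow>
          cinner H (vadd H x y) z = cinner H x z + cinner H y z"
    and inner_scale_left: "\<lbrakk>x \<in> vecs H; y \<in> vecs H\<rbrakk> \<Longrightarrow>
          cinner H (vscale H a x) y = a * cinner H x y"
    and inner_ge_zero: "x \<in> vecs H \<Longrightarrow> 0 \<le> Re (cinner H x x)"
    and inner_eq_zero: "\<lbrakk>x \<in> vecs H; cinner H x x = 0\<rbrakk> \<Longrightarrow> x = vzero H"

context complex_inner_space
begin

lemma inner_add_right:
  assumes "x \<in> vecs H" "y \<in> vecs H" "z \<in> vecs H"
  shows "cinner H z (vadd H x y) = cinner H z x + cinner H z y"
  using inner_commute[OF add_in[OF assms(1,2)] assms(3)] inner_commute[OF assms(1,3)]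
    inner_commute[OF assms(2,3)] inner_add_left[OF assms] by simp

lemma inner_scale_right:
  assumes "x \<in> vecs H" "y \<in> vecs H"
  shows "cinner H x (vscale H a y) = cnj a * cinner H x y"
  using inner_commute[OF scale_in[OF assms(2)] assms(1)] inner_commute[OF assms(2,1)]
    inner_scale_left[OF assms(2,1)] by simp

lemma Re_inner_expand:
  assumes "x \<in> vecs H" "y \<in> vecs H"
  shows "Re (cinner H (vadd H x (vscale H (complex_of_real t) y)) (vadd H x (vscale H (complex_of_real t) y)))
    = Re (cinner H x x) + 2 * t * Re (cinner H x y) + t\<^sup>2 * Re (cinner H y y)"
proof -
  have "Re (cinner H y x) = Re (cinner H x y)"
    using inner_commute[OF assms] by simp
  then show ?thesis
    using assms by (simp add: inner_add_left inner_add_right inner_scale_left inner_scale_right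
        add_in scale_in power2_eq_square algebra_simps)
qed

lemma Re_inner_le:
  assumes x: "x \<in> vecs H" and y: "y \<in> vecs H"
  shows "Re (cinner H x y) \<le> vnorm H x * vnorm H y"
proof -
  let ?a = "Re (cinner H x x)" and ?b = "Re (cinner H x y)" and ?c = "Re (cinner H y y)"
  have q: "0 \<le> ?a + 2 * t * ?b + t\<^sup>2 * ?c" for t
    using Re_inner_expand[OF x y, of t] inner_ge_zero[OF add_in[OF x scale_in[OF y]]] by metis
  have a: "0 \<le> ?a" and c: "0 \<le> ?c" using inner_ge_zero x y by auto
  have "?b\<^sup>2 \<le> ?a * ?c"
  proof (cases "?c = 0")
    case True
    have "?b = 0"
    proof (rule ccontr)
      assume "?b \<noteq> 0"
      then show False using q[of "- (?a + 1) / (2 * ?b)"] True by (simp add: field_simps)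
    qed
    then show ?thesis using True by simp
  next
    case False
    then have "0 < ?c" using c by simp
    then show ?thesis using q[of "- ?b / ?c"] by (simp add: field_simps power2_eq_square)
  qed
  then have "\<bar>?b\<bar> \<le> sqrt (?a * ?c)" by (metis real_sqrt_abs real_sqrt_le_mono)
  then show ?thesis by (simp add: vnorm_def real_sqrt_mult)
qed

lemma norm_triangle:
  assumes x: "x \<in> vecs H" and y: "y \<in> vecs H"
  shows "vnorm H (vadd H x y) \<le> vnorm H x + vnorm H y"
proof -
  have "(vnorm H (vadd H x y))\<^sup>2 = (vnorm H x)\<^sup>2 + 2 * Re (cinner H x y) + (vnorm H y)\<^sup>2"
    using Re_inner_expand[OF x y, of 1] inner_ge_zero[OF x] inner_ge_zero[OF y]
      inner_ge_zero[OF add_in[OF x y]] y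
    by (simp add: scale_one vnorm_def)
  also have "\<dots> \<le> (vnorm H x + vnorm H y)\<^sup>2"
    using Re_inner_le[OF x y] by (simp add: power2_sum)
  finally show ?thesis
    by (rule power2_le_imp_le) (simp add: vnorm_def inner_ge_zero x y)
qed

lemma norm_diff_commute:
  assumes x: "x \<in> vecs H" and y: "y \<in> vecs H"
  shows "vnorm H (vadd H x (vscale H (-1) y)) = vnorm H (vadd H y (vscale H (-1) x))"
  using Re_inner_expand[OF x y, of "-1"] Re_inner_expand[OF y x, of "-1"] inner_commute[OF x y]
  by (simp add: vnorm_def)

lemma diff_add_diff:
  assumes x: "x \<in> vecs H" and y: "y \<in> vecs H" and z: "z \<in> vecs H"
  shows "vadd H (vadd H x (vscale H (-1) y)) (vadd H y (vscale H (-1) z)) = vadd H x (vscale H (-1) z)"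
proof -
  let ?y = "vscale H (-1) y" and ?z = "vscale H (-1) z"
  have y': "?y \<in> vecs H" and z': "?z \<in> vecs H" using y z by (auto intro: scale_in)
  have "vadd H (vadd H x ?y) (vadd H y ?z) = vadd H x (vadd H ?y (vadd H y ?z))"
    by (rule add_assoc[OF x y' add_in[OF y z']])
  also have "vadd H ?y (vadd H y ?z) = vadd H (vadd H ?y y) ?z"
    by (rule add_assoc[OF y' y z', symmetric])
  also have "vadd H ?y y = vzero H"
    using add_commute[OF y' y] add_inverse[OF y] by simp
  also have "vadd H (vzero H) ?z = ?z"
    using add_commute[OF zero_in z'] add_zero[OF z'] by simp
  finally show ?thesis .
qed

lemma diff_eq_zero:
  assumes x: "x \<in> vecs H" and y: "y \<in> vecs H" and e: "vadd H x (vscale H (-1) y) = vzero H"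
  shows "x = y"
proof -
  let ?y = "vscale H (-1) y"
  have y': "?y \<in> vecs H" using y by (rule scale_in)
  have "x = vadd H x (vadd H ?y y)"
    using add_commute[OF y' y] add_inverse[OF y] add_zero[OF x] by simp
  also have "\<dots> = vadd H (vzero H) y"
    using add_assoc[OF x y' y] e by simp
  also have "\<dots> = y"
    using add_commute[OF zero_in y] add_zero[OF y] by simp
  finally show ?thesis .
qed

lemma Im_inner_self: "x \<in> vecs H \<Longrightarrow> Im (cinner H x x) = 0"
  using inner_commute[of x x] by (simp add: complex_eq_iff)

lemma zero_inner: "x \<in> vecs H \<Longrightarrow> cinner H (vzero H) x = 0"
  using inner_add_left[OF zero_in zero_in, of x] add_zero[OF zero_in] by simp

lemma metric_space_vecs: "Metric_space (vecs H) (vdist H)"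
proof
  show "0 \<le> vdist H x y" for x y
    by (simp add: vdist_def vnorm_def inner_ge_zero add_in scale_in)
  show "vdist H x y = vdist H y x" for x y
    by (simp add: vdist_def norm_diff_commute)
  fix x y assume xy: "x \<in> vecs H" "y \<in> vecs H"
  show "vdist H x y = 0 \<longleftrightarrow> x = y"
  proof
    assume "vdist H x y = 0"
    then have "cinner H (vadd H x (vscale H (-1) y)) (vadd H x (vscale H (-1) y)) = 0"
      using xy by (simp add: vdist_def vnorm_def complex_eq_iff Im_inner_self add_in scale_in)
    then have "vadd H x (vscale H (-1) y) = vzero H"
      using xy by (intro inner_eq_zero add_in scale_in)
    then show "x = y" using xy by (rule diff_eq_zero[rotated 2])
  next
    assume "x = y"
    then show "vdist H x y = 0"
      using xy by (simp add: vdist_def vnorm_def add_inverse zero_inner zero_in)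
  qed
  fix z assume z: "z \<in> vecs H"
  show "vdist H x z \<le> vdist H x y + vdist H y z"
    using norm_triangle[of "vadd H x (vscale H (-1) y)" "vadd H y (vscale H (-1) z)"] xy z
    by (simp add: vdist_def diff_add_diff add_in scale_in)
qed

end

locale complex_hilbert_space = complex_inner_space +
  assumes complete: "Metric_space.mcomplete (vecs H) (vdist H)"

text \<open>
  An operator is identified with its graph, its domain being \<^const>\<open>Domain\<close> of the graph.
  Since \<^term>\<open>B O A\<close> relates \<open>x\<close> to \<open>z\<close> iff \<open>(x, y) \<in> B\<close> and \<open>(y, z) \<in> A\<close> for some \<open>y\<close>,
  it is the graph of the product \<open>AB\<close> (first \<open>B\<close>, then \<open>A\<close>) on its maximal domain; likewise
  \<^term>\<open>A ^^ n\<close> is the graph of the \<open>n\<close>-th power of \<open>A\<close>, with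
  \<open>h \<in> Domain (A ^^ Suc k)\<close> iff \<open>h \<in> Domain (A ^^ k)\<close> and \<open>A\<^sup>k h \<in> Domain A\<close>.
\<close>

type_synonym 'h operator = "('h \<times> 'h) set"

definition linear_operator :: "'h cspace \<Rightarrow> 'h operator \<Rightarrow> bool" where
  "linear_operator H A \<longleftrightarrow>
     A \<subseteq> vecs H \<times> vecs H \<and> single_valued A \<and> (vzero H, vzero H) \<in> A \<and>
     (\<forall>x y x' y'. (x, y) \<in> A \<longrightarrow> (x', y') \<in> A \<longrightarrow> (vadd H x x', vadd H y y') \<in> A) \<and>
     (\<forall>a x y. (x, y) \<in> A \<longrightarrow> (vscale H a x, vscale H a y) \<in> A)"

definition densely_defined :: "'h cspace \<Rightarrow> 'h operator \<Rightarrow> bool" where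
  "densely_defined H A \<longleftrightarrow> vtopology H closure_of Domain A = vecs H"

definition closed_operator :: "'h cspace \<Rightarrow> 'h operator \<Rightarrow> bool" where
  "closed_operator H A \<longleftrightarrow> closedin (prod_topology (vtopology H) (vtopology H)) A"

definition adjoint_op :: "'h cspace \<Rightarrow> 'h operator \<Rightarrow> 'h operator" where
  "adjoint_op H A =
     {(y, z). y \<in> vecs H \<and> z \<in> vecs H \<and> (\<forall>(x, w) \<in> A. cinner H w y = cinner H x z)}"

definition normal_operator :: "'h cspace \<Rightarrow> 'h operator \<Rightarrow> bool" where
  "normal_operator H N \<longleftrightarrow>
     linear_operator H N \<and> densely_defined H N \<and> closed_operator H N \<and>
     adjoint_op H N O N = N O adjoint_op H N"

definition isometric_embedding :: "'h cspace \<Rightarrow> 'k cspace \<Rightarrow> ('h \<Rightarrow> 'k) \<Rightarrow> bool" where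
  "isometric_embedding H K V \<longleftrightarrow>
     V \<in> vecs H \<rightarrow> vecs K \<and>
     (\<forall>x\<in>vecs H. \<forall>y\<in>vecs H. V (vadd H x y) = vadd K (V x) (V y)) \<and>
     (\<forall>a. \<forall>x\<in>vecs H. V (vscale H a x) = vscale K a (V x)) \<and>
     (\<forall>x\<in>vecs H. \<forall>y\<in>vecs H. cinner K (V x) (V y) = cinner H x y)"

text \<open>
  HOL cannot quantify over the type that carries \<open>K\<close>; it is taken to be the type that
  carries \<open>H\<close>. This loses no generality. If \<open>H\<close> is infinite-dimensional, a normal extension
  restricts to the smallest reducing subspace containing \<open>H\<close>, whose Hilbert dimension, and hence
  cardinality, is that of \<open>H\<close>. If \<open>H\<close> is finite-dimensional, a subnormal operator on
  \<open>H\<close> is already normal.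
\<close>

definition subnormal :: "'h cspace \<Rightarrow> 'h operator \<Rightarrow> bool" where
  "subnormal H A \<longleftrightarrow>
     linear_operator H A \<and> densely_defined H A \<and>
     (\<exists>(K :: 'h cspace) V N.
        complex_hilbert_space K \<and> isometric_embedding H K V \<and> normal_operator K N \<and>
        (\<forall>(h, g) \<in> A. (V h, V g) \<in> N))"

definition L2_fun :: "'a measure \<Rightarrow> ('a \<Rightarrow> complex) set" where
  "L2_fun M = {f \<in> borel_measurable M. integrable M (\<lambda>x. (cmod (f x))\<^sup>2)}"

definition AE_eq_rel :: "'a measure \<Rightarrow> (('a \<Rightarrow> complex) \<times> ('a \<Rightarrow> complex)) set" where
  "AE_eq_rel M = {(f, g). f \<in> L2_fun M \<and> g \<in> L2_fun M \<and> (AE x in M. f x = g x)}"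

abbreviation L2_class :: "'a measure \<Rightarrow> ('a \<Rightarrow> complex) \<Rightarrow> ('a \<Rightarrow> complex) set" where
  "L2_class M f \<equiv> AE_eq_rel M `` {f}"

definition L2 :: "'a measure \<Rightarrow> ('a \<Rightarrow> complex) set cspace" where
  "L2 M = \<lparr>
     vecs = L2_fun M // AE_eq_rel M,
     vzero = L2_class M (\<lambda>_. 0),
     vadd = (\<lambda>u v. \<Union>f\<in>u. \<Union>g\<in>v. L2_class M (\<lambda>x. f x + g x)),
     vscale = (\<lambda>a u. \<Union>f\<in>u. L2_class M (\<lambda>x. a * f x)),
     cinner = (\<lambda>u v. the_elem (\<Union>f\<in>u. \<Union>g\<in>v. {LINT x|M. f x * cnj (g x)}))\<rparr>"

lemma L2_fun_zero: "(\<lambda>_. 0) \<in> L2_fun M"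
  by (simp add: L2_fun_def)

lemma L2_fun_add:
  assumes "f \<in> L2_fun M" "g \<in> L2_fun M"
  shows "(\<lambda>x. f x + g x) \<in> L2_fun M"
proof -
  have [measurable]: "f \<in> borel_measurable M" "g \<in> borel_measurable M"
    using assms by (auto simp: L2_fun_def)
  have bound: "(cmod (f x + g x))\<^sup>2 \<le> 2 * (cmod (f x))\<^sup>2 + 2 * (cmod (g x))\<^sup>2" for x
  proof -
    have "(cmod (f x + g x))\<^sup>2 \<le> (cmod (f x) + cmod (g x))\<^sup>2"
      by (simp add: norm_triangle_ineq power_mono)
    also have "\<dots> \<le> 2 * (cmod (f x))\<^sup>2 + 2 * (cmod (g x))\<^sup>2"
      using sum_squares_bound[of "cmod (f x)" "cmod (g x)"] by (simp add: power2_sum)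
    finally show ?thesis .
  qed
  have "integrable M (\<lambda>x. (cmod (f x + g x))\<^sup>2)"
  proof (rule Bochner_Integration.integrable_bound)
    show "integrable M (\<lambda>x. 2 * (cmod (f x))\<^sup>2 + 2 * (cmod (g x))\<^sup>2)"
      using assms by (simp add: L2_fun_def)
    show "AE x in M. norm ((cmod (f x + g x))\<^sup>2) \<le> norm (2 * (cmod (f x))\<^sup>2 + 2 * (cmod (g x))\<^sup>2)"
      by (rule AE_I2) (use bound in simp)
  qed measurable
  then show ?thesis by (simp add: L2_fun_def)
qed

lemma L2_fun_scale: "f \<in> L2_fun M \<Longrightarrow> (\<lambda>x. a * f x) \<in> L2_fun M"
proof -
  assume "f \<in> L2_fun M"
  then have "f \<in> borel_measurable M" and "integrable M (\<lambda>x. (cmod a)\<^sup>2 * (cmod (f x))\<^sup>2)"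
    by (simp_all add: L2_fun_def)
  then show ?thesis by (simp add: L2_fun_def norm_mult power_mult_distrib)
qed

lemma borel_measurable_cnj: "cnj \<in> borel_measurable borel"
  by (intro borel_measurable_continuous_onI continuous_intros)

lemma L2_fun_integrable_mult:
  assumes "f \<in> L2_fun M" "g \<in> L2_fun M"
  shows "integrable M (\<lambda>x. f x * cnj (g x))"
proof -
  have [measurable]: "f \<in> borel_measurable M" "g \<in> borel_measurable M"
    using assms by (auto simp: L2_fun_def)
  have bound: "norm (f x * cnj (g x)) \<le> (cmod (f x))\<^sup>2 + (cmod (g x))\<^sup>2" for x
    using sum_squares_bound[of "cmod (f x)" "cmod (g x)"] mult_nonneg_nonneg[OF norm_ge_zero[of "f x"] norm_ge_zero[of "g x"]]
    unfolding norm_mult complex_mod_cnj by linarith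
  show ?thesis
  proof (rule Bochner_Integration.integrable_bound)
    show "integrable M (\<lambda>x. (cmod (f x))\<^sup>2 + (cmod (g x))\<^sup>2)"
      using assms by (simp add: L2_fun_def)
    show "(\<lambda>x. f x * cnj (g x)) \<in> borel_measurable M"
      by (intro borel_measurable_times measurable_compose[OF _ borel_measurable_cnj]) measurable
    show "AE x in M. norm (f x * cnj (g x)) \<le> norm ((cmod (f x))\<^sup>2 + (cmod (g x))\<^sup>2)"
      by (rule AE_I2) (use bound in simp)
  qed
qed

lemma equiv_AE_eq_rel: "equiv (L2_fun M) (AE_eq_rel M)"
proof (rule equivI)
  show "AE_eq_rel M \<subseteq> L2_fun M \<times> L2_fun M" by (auto simp: AE_eq_rel_def)
  show "refl_on (L2_fun M) (AE_eq_rel M)" by (auto simp: refl_on_def AE_eq_rel_def)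
  show "sym (AE_eq_rel M)" by (auto simp: sym_def AE_eq_rel_def elim: eventually_mono)
  show "trans (AE_eq_rel M)"
    unfolding trans_def AE_eq_rel_def by (auto elim: eventually_elim2)
qed

lemma L2_class_eq_iff:
  assumes "f \<in> L2_fun M" "g \<in> L2_fun M"
  shows "L2_class M f = L2_class M g \<longleftrightarrow> (AE x in M. f x = g x)"
  using eq_equiv_class_iff[OF equiv_AE_eq_rel assms] assms by (simp add: AE_eq_rel_def)

lemma vecs_L2E:
  assumes "u \<in> vecs (L2 M)"
  obtains f where "f \<in> L2_fun M" "u = L2_class M f"
  using assms by (auto simp: L2_def elim: quotientE)

lemma L2_class_in_vecs: "f \<in> L2_fun M \<Longrightarrow> L2_class M f \<in> vecs (L2 M)"
  by (simp add: L2_def quotientI)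

lemma vzero_L2: "vzero (L2 M) = L2_class M (\<lambda>_. 0)"
  by (simp add: L2_def)

lemma vadd_L2:
  assumes "f \<in> L2_fun M" "g \<in> L2_fun M"
  shows "vadd (L2 M) (L2_class M f) (L2_class M g) = L2_class M (\<lambda>x. f x + g x)"
proof -
  have "congruent2 (AE_eq_rel M) (AE_eq_rel M) (\<lambda>f g. L2_class M (\<lambda>x. f x + g x))"
  proof (rule congruent2I')
    fix f f' g g' assume *: "(f, f') \<in> AE_eq_rel M" "(g, g') \<in> AE_eq_rel M"
    then have "AE x in M. f x + g x = f' x + g' x"
      by (auto simp: AE_eq_rel_def)
    then show "L2_class M (\<lambda>x. f x + g x) = L2_class M (\<lambda>x. f' x + g' x)"
      using * by (subst L2_class_eq_iff) (auto simp: AE_eq_rel_def L2_fun_add)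
  qed
  then show ?thesis
    using UN_equiv_class2[OF equiv_AE_eq_rel equiv_AE_eq_rel _ assms] by (simp add: L2_def)
qed

lemma vscale_L2:
  assumes "f \<in> L2_fun M"
  shows "vscale (L2 M) a (L2_class M f) = L2_class M (\<lambda>x. a * f x)"
proof -
  have "congruent (AE_eq_rel M) (\<lambda>f. L2_class M (\<lambda>x. a * f x))"
  proof (rule congruentI)
    fix f f' assume *: "(f, f') \<in> AE_eq_rel M"
    then have "AE x in M. a * f x = a * f' x"
      by (auto simp: AE_eq_rel_def)
    then show "L2_class M (\<lambda>x. a * f x) = L2_class M (\<lambda>x. a * f' x)"
      using * by (subst L2_class_eq_iff) (auto simp: AE_eq_rel_def L2_fun_scale)
  qed
  then show ?thesis
    using UN_equiv_class[OF equiv_AE_eq_rel _ assms] by (simp add: L2_def)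
qed

lemma cinner_L2:
  assumes "f \<in> L2_fun M" "g \<in> L2_fun M"
  shows "cinner (L2 M) (L2_class M f) (L2_class M g) = (LINT x|M. f x * cnj (g x))"
proof -
  have "congruent2 (AE_eq_rel M) (AE_eq_rel M) (\<lambda>f g. {LINT x|M. f x * cnj (g x)})"
  proof (rule congruent2I')
    fix f f' g g' assume *: "(f, f') \<in> AE_eq_rel M" "(g, g') \<in> AE_eq_rel M"
    then have "AE x in M. f x * cnj (g x) = f' x * cnj (g' x)"
      by (auto simp: AE_eq_rel_def)
    moreover have "f \<in> borel_measurable M" "f' \<in> borel_measurable M"
        "g \<in> borel_measurable M" "g' \<in> borel_measurable M"
      using * by (auto simp: AE_eq_rel_def L2_fun_def)
    moreover from this have "(\<lambda>x. cnj (g x)) \<in> borel_measurable M" "(\<lambda>x. cnj (g' x)) \<in> borel_measurable M"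
      by (simp_all add: measurable_compose[OF _ borel_measurable_cnj])
    ultimately show "{LINT x|M. f x * cnj (g x)} = {LINT x|M. f' x * cnj (g' x)}"
      by (intro arg_cong[where f = "\<lambda>c. {c}"] integral_cong_AE borel_measurable_times)
  qed
  from UN_equiv_class2[OF equiv_AE_eq_rel equiv_AE_eq_rel this assms]
  show ?thesis by (simp add: L2_def)
qed

lemma complex_inner_space_L2: "complex_inner_space (L2 M)"
proof
  show "vzero (L2 M) \<in> vecs (L2 M)"
    by (simp add: vzero_L2 L2_class_in_vecs L2_fun_zero)
  fix u v assume u: "u \<in> vecs (L2 M)" and v: "v \<in> vecs (L2 M)"
  obtain f g where f: "f \<in> L2_fun M" "u = L2_class M f" and g: "g \<in> L2_fun M" "v = L2_class M g"
    using u v by (meson vecs_L2E)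
  note [simp] = vadd_L2 vscale_L2 cinner_L2 vzero_L2 L2_fun_add L2_fun_scale L2_fun_zero
    L2_class_in_vecs f g L2_fun_integrable_mult
  show "vadd (L2 M) u v \<in> vecs (L2 M)" "vadd (L2 M) u v = vadd (L2 M) v u"
    by (simp_all add: add.commute)
  show "cinner (L2 M) v u = cnj (cinner (L2 M) u v)"
    using Bochner_Integration.integral_cnj[of M "\<lambda>x. f x * cnj (g x)"] by (simp add: mult.commute)
  show "vscale (L2 M) a (vadd (L2 M) u v) = vadd (L2 M) (vscale (L2 M) a u) (vscale (L2 M) a v)" for a
    by (simp add: distrib_left)
  show "cinner (L2 M) (vscale (L2 M) a u) v = a * cinner (L2 M) u v" for a
    by (simp add: mult.assoc)
  fix w assume "w \<in> vecs (L2 M)"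
  then obtain h where h[simp]: "h \<in> L2_fun M" "w = L2_class M h"
    by (meson vecs_L2E)
  show "vadd (L2 M) (vadd (L2 M) u v) w = vadd (L2 M) u (vadd (L2 M) v w)"
    by (simp add: add.assoc)
  show "cinner (L2 M) (vadd (L2 M) u v) w = cinner (L2 M) u w + cinner (L2 M) v w"
    by (simp add: distrib_right)
next
  fix u assume u: "u \<in> vecs (L2 M)"
  obtain f where f: "f \<in> L2_fun M" "u = L2_class M f"
    using u by (meson vecs_L2E)
  note [simp] = vadd_L2 vscale_L2 cinner_L2 vzero_L2 L2_fun_add L2_fun_scale L2_fun_zero
    L2_class_in_vecs f
  show "vscale (L2 M) a u \<in> vecs (L2 M)" "vscale (L2 M) 1 u = u"
    "vadd (L2 M) u (vzero (L2 M)) = u" for a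
    by simp_all
  have "vadd (L2 M) u (vscale (L2 M) (-1) u) = L2_class M (\<lambda>x. f x + (-1) * f x)"
    by (simp only: f vadd_L2 vscale_L2 L2_fun_scale)
  then show "vadd (L2 M) u (vscale (L2 M) (-1) u) = vzero (L2 M)"
    by (simp only: vzero_L2) simp
  show "vscale (L2 M) (a + b) u = vadd (L2 M) (vscale (L2 M) a u) (vscale (L2 M) b u)"
    "vscale (L2 M) a (vscale (L2 M) b u) = vscale (L2 M) (a * b) u" for a b
    by (simp_all add: distrib_right mult.assoc)
  have sq: "cinner (L2 M) u u = complex_of_real (LINT x|M. (cmod (f x))\<^sup>2)"
    by (simp only: f cinner_L2 complex_norm_square[symmetric] integral_complex_of_real)
  show "0 \<le> Re (cinner (L2 M) u u)" by (simp only: sq Re_complex_of_real) simp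
  assume "cinner (L2 M) u u = 0"
  then have "(LINT x|M. (cmod (f x))\<^sup>2) = 0" by (simp only: sq of_real_eq_0_iff)
  moreover have "integrable M (\<lambda>x. (cmod (f x))\<^sup>2)" using f(1) by (simp add: L2_fun_def)
  ultimately have "AE x in M. (cmod (f x))\<^sup>2 = 0"
    using integral_nonneg_eq_0_iff_AE[of M "\<lambda>x. (cmod (f x))\<^sup>2"] by simp
  then have "AE x in M. f x = 0" by simp
  then show "u = vzero (L2 M)"
    by (simp only: f vzero_L2 L2_class_eq_iff[OF f(1) L2_fun_zero])
qed

definition nonsingular_map :: "'a measure \<Rightarrow> ('a \<Rightarrow> 'a) \<Rightarrow> bool" where
  "nonsingular_map M \<phi> \<longleftrightarrow>
     \<phi> \<in> measurable M M \<and>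
     (\<forall>\<Delta>\<in>sets M. emeasure M \<Delta> = 0 \<longrightarrow> emeasure M (\<phi> -` \<Delta> \<inter> space M) = 0)"

definition composition_op :: "'a measure \<Rightarrow> ('a \<Rightarrow> 'a) \<Rightarrow> ('a \<Rightarrow> complex) set operator" where
  "composition_op M \<phi> = {(L2_class M f, L2_class M (f \<circ> \<phi>)) | f. f \<in> L2_fun M \<and> f \<circ> \<phi> \<in> L2_fun M}"

end

theory Submission
  imports Defs
begin

text \<open>
  A composition operator with symbol \<open>\<phi>\<close> on a measure space \<open>M\<close> is subnormal as soon as \<open>\<phi>\<close> is a
  factor of an invertible map \<open>\<Psi>\<close> of a measure space \<open>N\<close> that changes the measure by a function
  constant along its orbits. Indeed, composition with \<open>\<Psi>\<close> is then a normal operator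
  (\<open>normal_composition_op\<close>). If \<open>\<pi>\<close> is a measure-preserving map of \<open>N\<close> onto \<open>M\<close> with
  \<open>\<pi> \<circ> \<Psi> = \<phi> \<circ> \<pi>\<close>, then \<open>f \<mapsto> f \<circ> \<pi>\<close> embeds \<open>L\<^sup>2\<close> of \<open>M\<close> isometrically into \<open>L\<^sup>2\<close> of \<open>N\<close> and
  turns composition with \<open>\<phi>\<close> into composition with \<open>\<Psi>\<close>
  (\<open>subnormal_composition_op_if_normal_lift\<close>).

  The space \<open>N\<close> consists of the pairs \<open>(k, b)\<close> of a height \<open>k\<close>, an integer, and a branch \<open>b\<close> from a
  countable set; \<open>\<Psi>\<close> lowers the height by one. The mass of \<open>(k, b)\<close> is a power of a number \<open>t(b)\<close>
  with exponent \<open>k - n - l(b)\<close>, where \<open>l(b)\<close> is the level of \<open>b\<close>, so \<open>\<Psi>\<close> divides the mass by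
  \<open>t(b)\<close>. The space \<open>M\<close> arises by identifying branches at height \<open>k\<close> that agree below height \<open>k\<close>.
  It is a directed tree without root and leaves, and \<open>\<phi>\<close> sends a vertex to its parent. All masses
  are positive, so there are no null sets to take care of.

  The \<open>m\<close>-th power of the operator has as domain the functions \<open>f\<close> for which \<open>f \<circ> \<phi>\<^sup>j\<close> is square
  integrable for all \<open>j \<le> m\<close>. It is dense if every vertex has finite \<open>j\<close>-th generations of
  descendants, in measure, for \<open>j \<le> m\<close>, and it is trivial if the \<open>m\<close>-th generation of every
  vertex has infinite measure. The descendants of a vertex at height \<open>k\<close> in generation \<open>j\<close> have
  the total mass at height \<open>k + j\<close> of the branches through the vertex. All but one of these branches
  have level above \<open>k\<close>, and their masses have a finite sum for \<open>j \<le> n\<close> because the reciprocals of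
  the \<open>t(b)\<close> do (\<open>cell_mass_finite\<close>). Infinitely many of them have level \<open>k + 1\<close> and contribute
  mass \<open>1\<close> each for \<open>j = n + 1\<close> (\<open>cell_mass_infinite\<close>).
\<close>

section \<open>Inner products are continuous and adjoints are closed\<close>

context complex_inner_space
begin

lemma inner_diff_left:
  assumes "x \<in> vecs H" "y \<in> vecs H" "z \<in> vecs H"
  shows "cinner H (vadd H x (vscale H (-1) y)) z = cinner H x z - cinner H y z"
  using assms by (simp add: inner_add_left inner_scale_left scale_in)

lemma inner_cauchy_schwarz:
  assumes x: "x \<in> vecs H" and y: "y \<in> vecs H"
  shows "cmod (cinner H x y) \<le> vnorm H x * vnorm H y"
proof (cases "cinner H x y = 0")
  case True
  then show ?thesis using inner_ge_zero x y by (simp add: vnorm_def)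
next
  case False
  define c where "c = cinner H x y"
  define a where "a = cnj (sgn c)"
  have "cmod a = 1" using False by (simp add: a_def c_def norm_sgn)
  then have a: "a * cnj a = 1"
    using complex_norm_square[of a] by simp
  have "a * c = complex_of_real (cmod c)"
    using False complex_norm_square[of c]
    by (simp add: a_def c_def sgn_eq field_simps power2_eq_square)
  then have "cmod c = Re (cinner H (vscale H a x) y)"
    using x y by (simp add: inner_scale_left c_def)
  also have "\<dots> \<le> vnorm H (vscale H a x) * vnorm H y"
    using x y by (intro Re_inner_le scale_in)
  also have "cinner H (vscale H a x) (vscale H a x) = (a * cnj a) * cinner H x x"
    using x by (simp add: inner_scale_left inner_scale_right scale_in)
  then have "vnorm H (vscale H a x) = vnorm H x"
    using a by (simp add: vnorm_def)
  finally show ?thesis by (simp add: c_def)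
qed

lemma continuous_map_inner_left:
  assumes w: "w \<in> vecs H"
  shows "continuous_map (vtopology H) euclidean (\<lambda>y. cinner H y w)"
proof -
  interpret Metric_space "vecs H" "vdist H" by (rule metric_space_vecs)
  have "continuous_map mtopology (Met_TC.mtopology) (\<lambda>y. cinner H y w)"
    unfolding metric_continuous_map[OF Met_TC.Metric_space_axioms]
  proof (intro conjI ballI allI impI)
    fix a and \<epsilon> :: real assume a: "a \<in> vecs H" and \<epsilon>: "0 < \<epsilon>"
    have n: "0 \<le> vnorm H w" by (simp add: vnorm_def inner_ge_zero w)
    show "\<exists>\<delta>>0. \<forall>x. x \<in> vecs H \<and> vdist H a x < \<delta> \<longrightarrow> dist (cinner H a w) (cinner H x w) < \<epsilon>"
    proof (intro exI[of _ "\<epsilon> / (vnorm H w + 1)"] conjI allI impI)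
      show "0 < \<epsilon> / (vnorm H w + 1)" using \<epsilon> n by simp
      fix x assume x: "x \<in> vecs H \<and> vdist H a x < \<epsilon> / (vnorm H w + 1)"
      have "dist (cinner H a w) (cinner H x w) \<le> vdist H a x * vnorm H w"
        using inner_cauchy_schwarz[of "vadd H a (vscale H (-1) x)" w] a x w
        by (simp add: dist_norm inner_diff_left vdist_def add_in scale_in)
      also have "\<dots> \<le> vdist H a x * (vnorm H w + 1)"
        by (simp add: distrib_left)
      also have "\<dots> < \<epsilon>" using x n by (simp add: field_simps)
      finally show "dist (cinner H a w) (cinner H x w) < \<epsilon>" .
    qed
  qed auto
  then show ?thesis by (simp add: vtopology_def)
qed

lemma continuous_map_inner_right:
  assumes w: "w \<in> vecs H"
  shows "continuous_map (vtopology H) euclidean (\<lambda>y. cinner H w y)"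
proof -
  interpret Metric_space "vecs H" "vdist H" by (rule metric_space_vecs)
  have "continuous_map (vtopology H) euclidean (cnj \<circ> (\<lambda>y. cinner H y w))"
    by (rule continuous_map_compose[OF continuous_map_inner_left[OF w]])
      (simp add: continuous_map_iff_continuous2 continuous_intros)
  then show ?thesis
    by (rule continuous_map_eq) (use w in \<open>simp add: vtopology_def inner_commute[of _ w]\<close>)
qed

lemma topspace_vtopology [simp]: "topspace (vtopology H) = vecs H"
  by (simp add: vtopology_def Metric_space.topspace_mtopology[OF metric_space_vecs])

text \<open>
  The graph of an adjoint is cut out by the equations \<open>\<langle>w, y\<rangle> = \<langle>x, z\<rangle>\<close>, one for each pair in the
  graph of the operator, and both sides are continuous in \<open>(y, z)\<close>.
\<close>

lemma closed_adjoint: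
  assumes A: "A \<subseteq> vecs H \<times> vecs H"
  shows "closed_operator H (adjoint_op H A)"
proof -
  let ?T = "prod_topology (vtopology H) (vtopology H)"
  let ?E = "\<lambda>(x, w). {p \<in> topspace ?T. cinner H w (fst p) = cinner H x (snd p)}"
  have "closedin ?T (?E q)" if "q \<in> A" for q
  proof -
    obtain x w where q: "q = (x, w)" "x \<in> vecs H" "w \<in> vecs H"
      using A \<open>q \<in> A\<close> by auto
    have "continuous_map ?T euclidean ((\<lambda>y. cinner H w y) \<circ> fst)"
      "continuous_map ?T euclidean ((\<lambda>y. cinner H x y) \<circ> snd)"
      using q by (auto intro!: continuous_map_compose[OF _ continuous_map_inner_right]
          continuous_map_fst continuous_map_snd)
    from closedin_continuous_maps_eq[OF _ this] show ?thesis
      by (simp add: q o_def)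
  qed
  then have "closedin ?T (\<Inter> (insert (topspace ?T) (?E ` A)))"
    by (intro closedin_Inter) (auto simp del: topspace_prod_topology)
  then have "closedin ?T (topspace ?T \<inter> \<Inter> (?E ` A))"
    by simp
  also have "topspace ?T \<inter> \<Inter> (?E ` A) = adjoint_op H A"
    by (auto simp: adjoint_op_def split: prod.splits)
  finally show ?thesis unfolding closed_operator_def .
qed

end

section \<open>Square-integrable functions on countable atomic measure spaces\<close>

text \<open>
  Every function is measurable, no nonempty set is null, and convergence in the mean implies
  pointwise convergence. Equality of classes in \<open>L\<^sup>2\<close> is therefore equality of functions on
  the space.
\<close>

locale atomic_measure =
  fixes M :: "'a measure"
  assumes sets_eq_Pow: "sets M = Pow (space M)"
    and countable_space: "countable (space M)"
    and atom_pos: "x \<in> space M \<Longrightarrow> emeasure M {x} \<noteq> 0"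
    and atom_finite: "x \<in> space M \<Longrightarrow> emeasure M {x} \<noteq> \<infinity>"
begin

lemma measurable_any: "f \<in> space M \<rightarrow> space N \<Longrightarrow> f \<in> measurable M N"
  by (auto simp: measurable_def sets_eq_Pow)

lemma borel_measurable_any [measurable]: "f \<in> borel_measurable M"
  by (rule measurable_any) simp

lemma AE_iff_all: "(AE x in M. P x) \<longleftrightarrow> (\<forall>x\<in>space M. P x)"
proof
  assume "AE x in M. P x"
  then obtain N where N: "{x \<in> space M. \<not> P x} \<subseteq> N" "emeasure M N = 0" "N \<in> sets M"
    by (rule AE_E)
  show "\<forall>x\<in>space M. P x"
  proof (rule ballI, rule ccontr)
    fix x assume x: "x \<in> space M" "\<not> P x"
    then have "emeasure M {x} \<le> emeasure M N" using N by (intro emeasure_mono) auto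
    then show False using atom_pos x N(2) by simp
  qed
qed (auto intro: AE_I2)

lemma L2_class_eq_iff_all:
  assumes "f \<in> L2_fun M" "g \<in> L2_fun M"
  shows "L2_class M f = L2_class M g \<longleftrightarrow> (\<forall>x\<in>space M. f x = g x)"
  by (simp add: L2_class_eq_iff[OF assms] AE_iff_all)

lemma L2_fun_cong:
  assumes "\<And>x. x \<in> space M \<Longrightarrow> f x = g x"
  shows "f \<in> L2_fun M \<longleftrightarrow> g \<in> L2_fun M"
  using Bochner_Integration.integrable_cong[of M M "\<lambda>x. (cmod (f x))\<^sup>2" "\<lambda>x. (cmod (g x))\<^sup>2"] assms
  by (simp add: L2_fun_def)

lemma L2_fun_iff: "f \<in> L2_fun M \<longleftrightarrow> integrable M (\<lambda>x. (cmod (f x))\<^sup>2)"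
  by (simp add: L2_fun_def)

lemma sigma_finite: "sigma_finite_measure M"
proof
  show "\<exists>A. countable A \<and> A \<subseteq> sets M \<and> \<Union> A = space M \<and> (\<forall>a\<in>A. emeasure M a \<noteq> \<infinity>)"
    using countable_space sets_eq_Pow atom_finite
    by (intro exI[of _ "(\<lambda>x. {x}) ` space M"]) auto
qed

lemma nonsingular:
  assumes "\<phi> \<in> space M \<rightarrow> space M"
  shows "nonsingular_map M \<phi>"
  unfolding nonsingular_map_def
proof (intro conjI ballI impI)
  fix D assume D: "D \<in> sets M" "emeasure M D = 0"
  have "D = {}"
  proof (rule ccontr)
    assume "D \<noteq> {}"
    then obtain x where "x \<in> D" by auto
    then show False
      using emeasure_mono[of "{x}" D M] atom_pos[of x] D sets.sets_into_space[OF D(1)] by auto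
  qed
  then show "emeasure M (\<phi> -` D \<inter> space M) = 0" by simp
qed (rule measurable_any[OF assms])

lemma eq_density_count_space:
  "M = density (count_space (space M)) (\<lambda>x. ennreal (measure M {x}))"
proof (rule measure_eqI_countable[OF _ _ countable_space])
  fix x assume x: "x \<in> space M"
  then have "emeasure M {x} = ennreal (measure M {x})"
    using atom_finite by (intro emeasure_eq_ennreal_measure) auto
  also have "\<dots> = (\<integral>\<^sup>+ y. ennreal (measure M {x}) * indicator {x} y \<partial>count_space (space M))"
    using x by simp
  also have "\<dots> = emeasure (density (count_space (space M)) (\<lambda>x. ennreal (measure M {x}))) {x}"
    using x by (subst emeasure_density) (auto intro!: nn_integral_cong split: split_indicator)
  finally show "emeasure M {x} = emeasure (density (count_space (space M)) (\<lambda>x. ennreal (measure M {x}))) {x}" .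
qed (auto simp: sets_eq_Pow)

lemma integral_eq_count_space:
  fixes F :: "'a \<Rightarrow> 'b::{banach, second_countable_topology}"
  shows "(LINT x|M. F x) = (LINT x|count_space (space M). measure M {x} *\<^sub>R F x)"
  by (subst eq_density_count_space, subst integral_density) auto

lemma integrable_iff_count_space:
  fixes F :: "'a \<Rightarrow> 'b::{banach, second_countable_topology}"
  shows "integrable M F \<longleftrightarrow> integrable (count_space (space M)) (\<lambda>x. measure M {x} *\<^sub>R F x)"
  by (subst eq_density_count_space, subst integrable_density) auto

lemma measure_atom_pos: "x \<in> space M \<Longrightarrow> 0 < measure M {x}"
  using atom_pos atom_finite by (simp add: measure_def enn2real_positive_iff less_top zero_less_iff_neq_zero)

lemma indicator_L2:
  assumes "A \<in> sets M" "emeasure M A < \<infinity>"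
  shows "(\<lambda>x. c * indicator A x) \<in> L2_fun M"
proof -
  have "(\<lambda>x. (cmod (c * indicator A x))\<^sup>2) = (\<lambda>x. (cmod c)\<^sup>2 * indicator A x)"
    by (auto simp: fun_eq_iff split: split_indicator)
  then show ?thesis using assms by (simp add: L2_fun_iff)
qed

lemma vdist_L2_class:
  assumes "f \<in> L2_fun M" "g \<in> L2_fun M"
  shows "vdist (L2 M) (L2_class M f) (L2_class M g) = sqrt (LINT x|M. (cmod (f x - g x))\<^sup>2)"
proof -
  have d: "(\<lambda>x. f x + (-1) * g x) \<in> L2_fun M"
    using assms by (intro L2_fun_add L2_fun_scale)
  have "vdist (L2 M) (L2_class M f) (L2_class M g) = vnorm (L2 M) (L2_class M (\<lambda>x. f x + (-1) * g x))"
    using assms by (simp only: vdist_def L2_class_in_vecs vadd_L2 vscale_L2 L2_fun_scale simp_thms if_True)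
  also have "\<dots> = sqrt (Re (LINT x|M. complex_of_real ((cmod (f x + (-1) * g x))\<^sup>2)))"
    by (simp only: vnorm_def cinner_L2[OF d d] complex_norm_square)
  finally show ?thesis by (simp only: integral_complex_of_real Re_complex_of_real) simp
qed

lemma atom_le_integral:
  assumes "f \<in> L2_fun M" "x \<in> space M"
  shows "measure M {x} * (cmod (f x))\<^sup>2 \<le> (LINT y|M. (cmod (f y))\<^sup>2)"
proof -
  have "measure M {x} * (cmod (f x))\<^sup>2 = (LINT y|M. indicator {x} y * (cmod (f x))\<^sup>2)"
    using assms(2) by (simp add: sets_eq_Pow)
  also have "\<dots> \<le> (LINT y|M. (cmod (f y))\<^sup>2)"
    using assms atom_finite[of x] sets_eq_Pow
    by (intro integral_mono) (auto simp: L2_fun_iff less_top[symmetric] split: split_indicator)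
  finally show ?thesis .
qed

text \<open>
  A Cauchy sequence converges at each atom, because the value at an atom is controlled by the
  norm. Fatou's lemma shows that the pointwise limit is also the limit in the mean.
\<close>

theorem hilbert_space_L2: "complex_hilbert_space (L2 M)"
proof -
  interpret H: complex_inner_space "L2 M" by (rule complex_inner_space_L2)
  interpret H: Metric_space "vecs (L2 M)" "vdist (L2 M)" by (rule H.metric_space_vecs)
  show ?thesis
  proof
    show "H.mcomplete"
      unfolding H.mcomplete_def
    proof (intro allI impI)
      fix \<sigma> assume C: "H.MCauchy \<sigma>"
      then have "\<forall>i. \<exists>f. f \<in> L2_fun M \<and> \<sigma> i = L2_class M f"
        unfolding H.MCauchy_def by (metis rangeI subsetD vecs_L2E)
      then obtain f where f: "\<And>i. f i \<in> L2_fun M" and \<sigma>: "\<And>i. \<sigma> i = L2_class M (f i)"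
        by metis
      have fd: "(\<lambda>x. f i x - g x) \<in> L2_fun M" if "g \<in> L2_fun M" for i g
        using L2_fun_add[OF f L2_fun_scale[OF that, of "-1"], of i] by simp
      have d: "vdist (L2 M) (\<sigma> i) (\<sigma> j) = sqrt (LINT x|M. (cmod (f i x - f j x))\<^sup>2)" for i j
        by (simp add: \<sigma> vdist_L2_class f)
      have lt: "\<exists>N. \<forall>i\<ge>N. \<forall>j\<ge>N. (LINT x|M. (cmod (f i x - f j x))\<^sup>2) < \<epsilon>" if "0 < \<epsilon>" for \<epsilon>
      proof -
        obtain N where "\<forall>i j. N \<le> i \<longrightarrow> N \<le> j \<longrightarrow> vdist (L2 M) (\<sigma> i) (\<sigma> j) < sqrt \<epsilon>"
          using C \<open>0 < \<epsilon>\<close> unfolding H.MCauchy_def by (meson real_sqrt_gt_0_iff)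
        then show ?thesis by (intro exI[of _ N]) (simp add: d)
      qed
      have "convergent (\<lambda>i. f i x)" if x: "x \<in> space M" for x
      proof (rule Cauchy_convergent, rule metric_CauchyI)
        fix e :: real assume "0 < e"
        have m: "0 < measure M {x}" using x by (rule measure_atom_pos)
        then obtain N where N: "\<forall>i\<ge>N. \<forall>j\<ge>N. (LINT x|M. (cmod (f i x - f j x))\<^sup>2) < measure M {x} * e\<^sup>2"
          using lt[of "measure M {x} * e\<^sup>2"] \<open>0 < e\<close> by auto
        show "\<exists>N. \<forall>i\<ge>N. \<forall>j\<ge>N. dist (f i x) (f j x) < e"
        proof (intro exI allI impI)
          fix i j assume "N \<le> i" "N \<le> j"
          then have "measure M {x} * (cmod (f i x - f j x))\<^sup>2 < measure M {x} * e\<^sup>2"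
            using N atom_le_integral[OF fd[OF f[of j], of i] x] by fastforce
          then have "(cmod (f i x - f j x))\<^sup>2 < e\<^sup>2" using m by simp
          then show "dist (f i x) (f j x) < e"
            using \<open>0 < e\<close> by (simp add: dist_norm power_less_imp_less_base)
        qed
      qed
      then obtain g where g: "\<And>x. x \<in> space M \<Longrightarrow> (\<lambda>i. f i x) \<longlonglongrightarrow> g x"
        unfolding convergent_def by metis
      have close: "(\<lambda>x. f i x - g x) \<in> L2_fun M \<and> (LINT x|M. (cmod (f i x - g x))\<^sup>2) \<le> \<epsilon>"
        if N: "\<forall>i\<ge>N. \<forall>j\<ge>N. (LINT x|M. (cmod (f i x - f j x))\<^sup>2) < \<epsilon>" and i: "N \<le> i" for N i \<epsilon>
      proof -
        have "0 \<le> (LINT x|M. (cmod (f i x - f i x))\<^sup>2)" by simp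
        also have "\<dots> < \<epsilon>" using N i by blast
        finally have \<epsilon>: "0 \<le> \<epsilon>" by simp
        have "(\<integral>\<^sup>+ x. ennreal ((cmod (f i x - g x))\<^sup>2) \<partial>M)
            = (\<integral>\<^sup>+ x. liminf (\<lambda>j. ennreal ((cmod (f i x - f j x))\<^sup>2)) \<partial>M)"
        proof (rule nn_integral_cong)
          fix x assume "x \<in> space M"
          then have "(\<lambda>j. ennreal ((cmod (f i x - f j x))\<^sup>2)) \<longlonglongrightarrow> ennreal ((cmod (f i x - g x))\<^sup>2)"
            by (intro tendsto_intros g tendsto_ennrealI)
          then show "ennreal ((cmod (f i x - g x))\<^sup>2) = liminf (\<lambda>j. ennreal ((cmod (f i x - f j x))\<^sup>2))"
            by (rule lim_imp_Liminf[OF sequentially_bot, symmetric])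
        qed
        also have "\<dots> \<le> liminf (\<lambda>j. \<integral>\<^sup>+ x. ennreal ((cmod (f i x - f j x))\<^sup>2) \<partial>M)"
          by (rule nn_integral_liminf) measurable
        also have "\<dots> \<le> ennreal \<epsilon>"
        proof (rule Liminf_le)
          show "\<forall>\<^sub>F j in sequentially. (\<integral>\<^sup>+ x. ennreal ((cmod (f i x - f j x))\<^sup>2) \<partial>M) \<le> ennreal \<epsilon>"
            using eventually_ge_at_top[of N]
          proof eventually_elim
            case (elim j)
            have "(\<integral>\<^sup>+ x. ennreal ((cmod (f i x - f j x))\<^sup>2) \<partial>M) = ennreal (LINT x|M. (cmod (f i x - f j x))\<^sup>2)"
              using fd[OF f] by (intro nn_integral_eq_integral) (auto simp: L2_fun_iff)
            then show ?case using N i elim by (simp add: ennreal_leI less_imp_le)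
          qed
        qed simp
        finally have le: "(\<integral>\<^sup>+ x. ennreal ((cmod (f i x - g x))\<^sup>2) \<partial>M) \<le> ennreal \<epsilon>" .
        then have "integrable M (\<lambda>x. (cmod (f i x - g x))\<^sup>2)"
          by (intro integrableI_bounded) (auto simp: less_top[symmetric] top_unique)
        moreover from this have "ennreal (LINT x|M. (cmod (f i x - g x))\<^sup>2) \<le> ennreal \<epsilon>"
          using le by (subst nn_integral_eq_integral[symmetric]) auto
        ultimately show ?thesis using \<epsilon> by (simp add: L2_fun_iff)
      qed
      obtain N where "\<forall>i\<ge>N. \<forall>j\<ge>N. (LINT x|M. (cmod (f i x - f j x))\<^sup>2) < 1" using lt[of 1] by auto
      then have "(\<lambda>x. f N x - g x) \<in> L2_fun M" using close by blast
      then have gL: "g \<in> L2_fun M" using fd[of "\<lambda>x. f N x - g x" N] by simp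
      show "\<exists>x. limitin H.mtopology \<sigma> x sequentially"
        unfolding H.limit_metric_sequentially
      proof (intro exI[of _ "L2_class M g"] conjI allI impI)
        show "L2_class M g \<in> vecs (L2 M)" using gL by (rule L2_class_in_vecs)
        fix \<epsilon> :: real assume "0 < \<epsilon>"
        then obtain N where N: "\<forall>i\<ge>N. \<forall>j\<ge>N. (LINT x|M. (cmod (f i x - f j x))\<^sup>2) < (\<epsilon>/2)\<^sup>2"
          using lt[of "(\<epsilon>/2)\<^sup>2"] by auto
        show "\<exists>N. \<forall>n\<ge>N. \<sigma> n \<in> vecs (L2 M) \<and> vdist (L2 M) (\<sigma> n) (L2_class M g) < \<epsilon>"
        proof (intro exI[of _ N] allI impI conjI)
          fix i assume "N \<le> i"
          then have "sqrt (LINT x|M. (cmod (f i x - g x))\<^sup>2) \<le> \<epsilon> / 2"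
            using close[OF N] \<open>0 < \<epsilon>\<close> by (intro real_le_lsqrt) auto
          then show "vdist (L2 M) (\<sigma> i) (L2_class M g) < \<epsilon>"
            using \<open>0 < \<epsilon>\<close> f gL by (simp add: \<sigma> vdist_L2_class)
          show "\<sigma> i \<in> vecs (L2 M)" by (simp add: \<sigma> L2_class_in_vecs f)
        qed
      qed
    qed
  qed
qed

text \<open>
  If \<open>f\<close> has finite support, \<open>f \<circ> \<theta>\<close> is a finite linear combination of the indicators of the
  fibres of \<open>\<theta>\<close>.
\<close>

lemma comp_finite_support_L2:
  assumes "finite {x \<in> space M. f x \<noteq> 0}" and \<theta>: "\<theta> \<in> space M \<rightarrow> space M"
    and fin: "\<And>x. x \<in> space M \<Longrightarrow> emeasure M (\<theta> -` {x} \<inter> space M) < \<infinity>"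
  shows "f \<circ> \<theta> \<in> L2_fun M"
proof -
  let ?F = "{x \<in> space M. f x \<noteq> 0}"
  have "(\<lambda>y. \<Sum>x\<in>F. f x * indicator (\<theta> -` {x} \<inter> space M) y) \<in> L2_fun M"
    if "finite F" "F \<subseteq> space M" for F
    using that
  proof induction
    case empty
    then show ?case using L2_fun_zero by simp
  next
    case (insert x F)
    then have "(\<lambda>y. f x * indicator (\<theta> -` {x} \<inter> space M) y + (\<Sum>x\<in>F. f x * indicator (\<theta> -` {x} \<inter> space M) y)) \<in> L2_fun M"
      using fin by (intro L2_fun_add indicator_L2) (auto simp: sets_eq_Pow)
    then show ?case by (simp only: sum.insert[OF insert(1,2)])
  qed
  then have "(\<lambda>y. \<Sum>x\<in>?F. f x * indicator (\<theta> -` {x} \<inter> space M) y) \<in> L2_fun M"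
    using assms(1) by blast
  also have "?this \<longleftrightarrow> f \<circ> \<theta> \<in> L2_fun M"
  proof (rule L2_fun_cong)
    fix y assume y: "y \<in> space M"
    have "(\<Sum>x\<in>?F. f x * indicator (\<theta> -` {x} \<inter> space M) y) = (\<Sum>x\<in>?F. if x = \<theta> y then f x else 0)"
      using y by (intro sum.cong) (auto split: split_indicator)
    also have "\<dots> = (f \<circ> \<theta>) y" using \<theta> y assms(1) by (auto simp: sum.delta)
    finally show "(\<Sum>x\<in>?F. f x * indicator (\<theta> -` {x} \<inter> space M) y) = (f \<circ> \<theta>) y" .
  qed
  finally show ?thesis .
qed

lemma finite_support_L2: "finite {x \<in> space M. f x \<noteq> 0} \<Longrightarrow> f \<in> L2_fun M"
proof -
  assume "finite {x \<in> space M. f x \<noteq> 0}"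
  then have "f \<circ> (\<lambda>x. x) \<in> L2_fun M"
  proof (rule comp_finite_support_L2)
    fix x assume "x \<in> space M"
    moreover from this have "(\<lambda>x. x) -` {x} \<inter> space M = {x}" by auto
    ultimately show "emeasure M ((\<lambda>x. x) -` {x} \<inter> space M) < \<infinity>"
      using atom_finite by (simp add: less_top)
  qed auto
  then show ?thesis by (simp add: o_def)
qed

text \<open>
  Cutting a function off to the first \<open>k\<close> points of an enumeration of the space approximates it
  in the mean, by dominated convergence.
\<close>

lemma densely_defined_if_finite_support:
  assumes A: "Domain A \<subseteq> vecs (L2 M)"
    and fs: "\<And>f. finite {x \<in> space M. f x \<noteq> 0} \<Longrightarrow> L2_class M f \<in> Domain A"
  shows "densely_defined (L2 M) A"
proof -
  interpret H: complex_inner_space "L2 M" by (rule complex_inner_space_L2)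
  interpret H: Metric_space "vecs (L2 M)" "vdist (L2 M)" by (rule H.metric_space_vecs)
  have "\<exists>v\<in>Domain A. v \<in> H.mball u r" if u: "u \<in> vecs (L2 M)" and r: "0 < r" for u r
  proof -
    obtain f where f: "f \<in> L2_fun M" and uf: "u = L2_class M f"
      using u by (rule vecs_L2E)
    define F where "F k = from_nat_into (space M) ` {..<k} \<inter> space M" for k :: nat
    define h where "h k x = (if x \<in> F k then f x else 0)" for k x
    have fin: "finite {x \<in> space M. h k x \<noteq> 0}" for k
      by (rule finite_subset[of _ "F k"]) (auto simp: h_def F_def)
    then have h: "h k \<in> L2_fun M" for k by (rule finite_support_L2)
    have "(\<lambda>k. LINT x|M. (cmod (f x - h k x))\<^sup>2) \<longlonglongrightarrow> (LINT x|M. 0)"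
    proof (rule integral_dominated_convergence)
      show "integrable M (\<lambda>x. (cmod (f x))\<^sup>2)" using f by (simp add: L2_fun_iff)
      show "AE x in M. (\<lambda>k. (cmod (f x - h k x))\<^sup>2) \<longlonglongrightarrow> 0"
      proof (rule AE_I2, rule tendsto_eventually)
        fix x assume x: "x \<in> space M"
        then obtain j where "from_nat_into (space M) j = x"
          using from_nat_into_surj[OF countable_space] by blast
        then have "x \<in> F k" if "Suc j \<le> k" for k
          using that x by (auto simp: F_def)
        then show "\<forall>\<^sub>F k in sequentially. (cmod (f x - h k x))\<^sup>2 = 0"
          unfolding eventually_sequentially by (intro exI[of _ "Suc j"]) (simp add: h_def)
      qed
      show "AE x in M. norm ((cmod (f x - h k x))\<^sup>2) \<le> (cmod (f x))\<^sup>2" for k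
        by (rule AE_I2) (simp add: h_def)
    qed measurable
    then have "(\<lambda>k. LINT x|M. (cmod (f x - h k x))\<^sup>2) \<longlonglongrightarrow> 0" by simp
    then have "\<forall>\<^sub>F k in sequentially. (LINT x|M. (cmod (f x - h k x))\<^sup>2) < r\<^sup>2"
      by (rule order_tendstoD) (use r in simp)
    then obtain k where "(LINT x|M. (cmod (f x - h k x))\<^sup>2) < r\<^sup>2"
      by (auto simp: eventually_sequentially)
    then have "vdist (L2 M) u (L2_class M (h k)) < r"
      using r by (simp add: uf vdist_L2_class f h real_less_lsqrt)
    then show ?thesis
      using fs[OF fin[of k]] u h by (intro bexI[of _ "L2_class M (h k)"]) (auto simp: L2_class_in_vecs)
  qed
  then show ?thesis
    unfolding densely_defined_def vtopology_def H.metric_closure_of by auto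
qed

end

section \<open>Weighted composition operators and normality\<close>

text \<open>
  This class of operators contains the composition operators and, for invertible symbols, their
  adjoints, so one computation gives the adjoint of both.
\<close>

definition weighted_composition_op ::
    "'a measure \<Rightarrow> ('a \<Rightarrow> complex) \<Rightarrow> ('a \<Rightarrow> 'a) \<Rightarrow> ('a \<Rightarrow> complex) set operator" where
  "weighted_composition_op M a \<Psi> = {(L2_class M f, L2_class M (\<lambda>x. a x * f (\<Psi> x))) | f.
     f \<in> L2_fun M \<and> (\<lambda>x. a x * f (\<Psi> x)) \<in> L2_fun M}"

lemma composition_op_eq_weighted: "composition_op M \<phi> = weighted_composition_op M (\<lambda>_. 1) \<phi>"
  by (simp add: composition_op_def weighted_composition_op_def o_def)

lemma weighted_composition_op_subset: "weighted_composition_op M a \<Psi> \<subseteq> vecs (L2 M) \<times> vecs (L2 M)"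
  by (auto simp: weighted_composition_op_def L2_class_in_vecs)

lemma in_weighted_composition_opI:
  "\<lbrakk>f \<in> L2_fun M; (\<lambda>x. a x * f (\<Psi> x)) \<in> L2_fun M\<rbrakk>
    \<Longrightarrow> (L2_class M f, L2_class M (\<lambda>x. a x * f (\<Psi> x))) \<in> weighted_composition_op M a \<Psi>"
  unfolding weighted_composition_op_def by blast

lemma in_weighted_composition_opE:
  assumes "(u, v) \<in> weighted_composition_op M a \<Psi>"
  obtains f where "f \<in> L2_fun M" "(\<lambda>x. a x * f (\<Psi> x)) \<in> L2_fun M"
    "u = L2_class M f" "v = L2_class M (\<lambda>x. a x * f (\<Psi> x))"
  using assms unfolding weighted_composition_op_def by blast

context atomic_measure
begin

lemma linear_weighted_composition_op:
  assumes \<Psi>: "\<Psi> \<in> space M \<rightarrow> space M"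
  shows "linear_operator (L2 M) (weighted_composition_op M a \<Psi>)"
  unfolding linear_operator_def
proof (intro conjI allI impI)
  let ?W = "weighted_composition_op M a \<Psi>"
  show "?W \<subseteq> vecs (L2 M) \<times> vecs (L2 M)" by (rule weighted_composition_op_subset)
  show "single_valued ?W"
  proof (rule single_valuedI)
    fix u v w assume "(u, v) \<in> ?W" "(u, w) \<in> ?W"
    then obtain f g where
      f: "f \<in> L2_fun M" "(\<lambda>x. a x * f (\<Psi> x)) \<in> L2_fun M"
        "u = L2_class M f" "v = L2_class M (\<lambda>x. a x * f (\<Psi> x))" and
      g: "g \<in> L2_fun M" "(\<lambda>x. a x * g (\<Psi> x)) \<in> L2_fun M"
        "u = L2_class M g" "w = L2_class M (\<lambda>x. a x * g (\<Psi> x))"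
      by (elim in_weighted_composition_opE)
    have "\<forall>x\<in>space M. f x = g x"
      using f(3) g(3) L2_class_eq_iff_all[OF f(1) g(1)] by simp
    then have "\<forall>x\<in>space M. a x * f (\<Psi> x) = a x * g (\<Psi> x)"
      using \<Psi> by auto
    then show "v = w" using L2_class_eq_iff_all[OF f(2) g(2)] f(4) g(4) by simp
  qed
  show "(vzero (L2 M), vzero (L2 M)) \<in> ?W"
    using in_weighted_composition_opI[of "\<lambda>_. 0" M a \<Psi>] by (simp add: vzero_L2 L2_fun_zero)
next
  fix u v u' v' assume "(u, v) \<in> weighted_composition_op M a \<Psi>" "(u', v') \<in> weighted_composition_op M a \<Psi>"
  then obtain f g where
    f: "f \<in> L2_fun M" "(\<lambda>x. a x * f (\<Psi> x)) \<in> L2_fun M"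
      "u = L2_class M f" "v = L2_class M (\<lambda>x. a x * f (\<Psi> x))" and
    g: "g \<in> L2_fun M" "(\<lambda>x. a x * g (\<Psi> x)) \<in> L2_fun M"
      "u' = L2_class M g" "v' = L2_class M (\<lambda>x. a x * g (\<Psi> x))"
    by (elim in_weighted_composition_opE)
  have "vadd (L2 M) u u' = L2_class M (\<lambda>x. f x + g x)"
    by (simp only: f(3) g(3) vadd_L2[OF f(1) g(1)])
  moreover have "vadd (L2 M) v v' = L2_class M (\<lambda>x. a x * (f (\<Psi> x) + g (\<Psi> x)))"
    by (simp only: f(4) g(4) vadd_L2[OF f(2) g(2)] distrib_left)
  ultimately show "(vadd (L2 M) u u', vadd (L2 M) v v') \<in> weighted_composition_op M a \<Psi>"
    using in_weighted_composition_opI[OF L2_fun_add[OF f(1) g(1)], of a \<Psi>] L2_fun_add[OF f(2) g(2)]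
    by (simp add: distrib_left)
next
  fix c u v assume "(u, v) \<in> weighted_composition_op M a \<Psi>"
  then obtain f where f: "f \<in> L2_fun M" "(\<lambda>x. a x * f (\<Psi> x)) \<in> L2_fun M"
      "u = L2_class M f" "v = L2_class M (\<lambda>x. a x * f (\<Psi> x))"
    by (elim in_weighted_composition_opE)
  have "vscale (L2 M) c u = L2_class M (\<lambda>x. c * f x)"
    by (simp only: f(3) vscale_L2[OF f(1)])
  moreover have "vscale (L2 M) c v = L2_class M (\<lambda>x. a x * (c * f (\<Psi> x)))"
    by (simp only: f(4) vscale_L2[OF f(2)] mult.left_commute)
  ultimately show "(vscale (L2 M) c u, vscale (L2 M) c v) \<in> weighted_composition_op M a \<Psi>"
    using in_weighted_composition_opI[OF L2_fun_scale[OF f(1), of c], of a \<Psi>] L2_fun_scale[OF f(2), of c]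
    by (simp add: mult.left_commute)
qed

text \<open>
  The middle condition keeps track of the domain of the first factor. It is the delicate part
  when products of unbounded operators are compared.
\<close>

lemma relcomp_weighted_composition_op:
  assumes \<Theta>: "\<Theta> \<in> space M \<rightarrow> space M"
  shows "weighted_composition_op M a \<Psi> O weighted_composition_op M b \<Theta> =
    {(L2_class M f, L2_class M (\<lambda>x. b x * (a (\<Theta> x) * f (\<Psi> (\<Theta> x))))) | f.
      f \<in> L2_fun M \<and> (\<lambda>x. a x * f (\<Psi> x)) \<in> L2_fun M \<and>
      (\<lambda>x. b x * (a (\<Theta> x) * f (\<Psi> (\<Theta> x)))) \<in> L2_fun M}" (is "?L = ?R")
proof
  show "?L \<subseteq> ?R"
  proof (rule subrelI)
    fix u w assume "(u, w) \<in> ?L"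
    then obtain v where "(u, v) \<in> weighted_composition_op M a \<Psi>" "(v, w) \<in> weighted_composition_op M b \<Theta>"
      by auto
    then obtain f g where
      f: "f \<in> L2_fun M" "(\<lambda>x. a x * f (\<Psi> x)) \<in> L2_fun M"
        "u = L2_class M f" "v = L2_class M (\<lambda>x. a x * f (\<Psi> x))" and
      g: "g \<in> L2_fun M" "(\<lambda>x. b x * g (\<Theta> x)) \<in> L2_fun M"
        "v = L2_class M g" "w = L2_class M (\<lambda>x. b x * g (\<Theta> x))"
      by (elim in_weighted_composition_opE)
    have eq: "\<forall>x\<in>space M. g x = a x * f (\<Psi> x)"
      using L2_class_eq_iff_all[OF g(1) f(2)] f(4) g(3) by simp
    have eq': "b x * g (\<Theta> x) = b x * (a (\<Theta> x) * f (\<Psi> (\<Theta> x)))" if "x \<in> space M" for x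
      using eq \<Theta> that by auto
    have L: "(\<lambda>x. b x * (a (\<Theta> x) * f (\<Psi> (\<Theta> x)))) \<in> L2_fun M"
      using g(2) L2_fun_cong[OF eq'] by simp
    then have "w = L2_class M (\<lambda>x. b x * (a (\<Theta> x) * f (\<Psi> (\<Theta> x))))"
      using L2_class_eq_iff_all[OF g(2) L] eq' g(4) by simp
    then show "(u, w) \<in> ?R" using f L by blast
  qed
  show "?R \<subseteq> ?L"
  proof (rule subrelI)
    fix u w assume "(u, w) \<in> ?R"
    then obtain f where f: "f \<in> L2_fun M" "(\<lambda>x. a x * f (\<Psi> x)) \<in> L2_fun M"
      "(\<lambda>x. b x * (a (\<Theta> x) * f (\<Psi> (\<Theta> x)))) \<in> L2_fun M" "u = L2_class M f"
      "w = L2_class M (\<lambda>x. b x * (a (\<Theta> x) * f (\<Psi> (\<Theta> x))))"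
      by blast
    show "(u, w) \<in> ?L"
      using in_weighted_composition_opI[OF f(1,2)] in_weighted_composition_opI[OF f(2,3)]
      unfolding f(4,5) by blast
  qed
qed

text \<open>
  The substitution \<open>y = \<Psi> x\<close> in the inner product shows that the operator with weight \<open>b\<close> and
  symbol \<open>\<Psi>\<^sup>-\<^sup>1\<close> is contained in the adjoint, where \<open>b\<close> absorbs the change of mass under \<open>\<Psi>\<close>.
  Testing the adjoint on indicators of points shows that there is nothing else in it.
\<close>

lemma adjoint_weighted_composition_op:
  fixes a b :: "'a \<Rightarrow> complex"
  assumes \<Psi>: "bij_betw \<Psi> (space M) (space M)"
    and inv: "\<And>x. x \<in> space M \<Longrightarrow> \<Psi>' (\<Psi> x) = x"
    and b: "\<And>x. x \<in> space M \<Longrightarrow> b (\<Psi> x) * measure M {\<Psi> x} = cnj (a x) * measure M {x}"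
  shows "adjoint_op (L2 M) (weighted_composition_op M a \<Psi>) = weighted_composition_op M b \<Psi>'"
proof
  have \<Psi>_in: "\<Psi> x \<in> space M" if "x \<in> space M" for x
    using \<Psi> that by (auto simp: bij_betw_def)
  have transfer: "(LINT x|M. (a x * f (\<Psi> x)) * cnj (g x)) = (LINT y|M. f y * cnj (b y * g (\<Psi>' y)))" for f g
  proof -
    have "(LINT y|M. f y * cnj (b y * g (\<Psi>' y)))
        = (LINT y|count_space (space M). measure M {y} *\<^sub>R (f y * cnj (b y * g (\<Psi>' y))))"
      by (rule integral_eq_count_space)
    also have "\<dots> = (LINT x|count_space (space M). measure M {\<Psi> x} *\<^sub>R (f (\<Psi> x) * cnj (b (\<Psi> x) * g (\<Psi>' (\<Psi> x)))))"
      by (rule integral_bij_count_space[OF \<Psi>, symmetric])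
    also have "\<dots> = (LINT x|count_space (space M). measure M {x} *\<^sub>R ((a x * f (\<Psi> x)) * cnj (g x)))"
    proof (intro Bochner_Integration.integral_cong refl)
      fix x assume "x \<in> space (count_space (space M))"
      then have "cnj (b (\<Psi> x)) * measure M {\<Psi> x} = a x * measure M {x}"
        using arg_cong[OF b[of x], of cnj] by simp
      then have "(cnj (b (\<Psi> x)) * measure M {\<Psi> x}) * (f (\<Psi> x) * cnj (g x))
          = (a x * measure M {x}) * (f (\<Psi> x) * cnj (g x))"
        by simp
      then show "measure M {\<Psi> x} *\<^sub>R (f (\<Psi> x) * cnj (b (\<Psi> x) * g (\<Psi>' (\<Psi> x))))
          = measure M {x} *\<^sub>R ((a x * f (\<Psi> x)) * cnj (g x))"
        using \<open>x \<in> _\<close> by (simp add: inv scaleR_conv_of_real mult_ac)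
    qed
    also have "\<dots> = (LINT x|M. (a x * f (\<Psi> x)) * cnj (g x))"
      by (rule integral_eq_count_space[symmetric])
    finally show ?thesis by simp
  qed
  show "weighted_composition_op M b \<Psi>' \<subseteq> adjoint_op (L2 M) (weighted_composition_op M a \<Psi>)"
  proof (rule subrelI)
    fix v z assume "(v, z) \<in> weighted_composition_op M b \<Psi>'"
    then obtain g where g: "g \<in> L2_fun M" "(\<lambda>x. b x * g (\<Psi>' x)) \<in> L2_fun M"
        "v = L2_class M g" "z = L2_class M (\<lambda>x. b x * g (\<Psi>' x))"
      by (elim in_weighted_composition_opE)
    have "cinner (L2 M) w v = cinner (L2 M) u z" if uw: "(u, w) \<in> weighted_composition_op M a \<Psi>" for u w
    proof -
      obtain f where f: "f \<in> L2_fun M" "(\<lambda>x. a x * f (\<Psi> x)) \<in> L2_fun M"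
          "u = L2_class M f" "w = L2_class M (\<lambda>x. a x * f (\<Psi> x))"
        using uw by (elim in_weighted_composition_opE)
      show ?thesis
        by (simp only: f(3,4) g(3,4) cinner_L2 f(1,2) g(1,2) transfer)
    qed
    then show "(v, z) \<in> adjoint_op (L2 M) (weighted_composition_op M a \<Psi>)"
      using g by (auto simp: adjoint_op_def L2_class_in_vecs)
  qed
  show "adjoint_op (L2 M) (weighted_composition_op M a \<Psi>) \<subseteq> weighted_composition_op M b \<Psi>'"
  proof (rule subrelI)
    fix v z assume vz: "(v, z) \<in> adjoint_op (L2 M) (weighted_composition_op M a \<Psi>)"
    then obtain g h where g: "g \<in> L2_fun M" "v = L2_class M g" and h: "h \<in> L2_fun M" "z = L2_class M h"
      unfolding adjoint_op_def by (blast elim: vecs_L2E)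
    have eq: "h y = b y * g (\<Psi>' y)" if y: "y \<in> space M" for y
    proof -
      obtain x where x: "x \<in> space M" "y = \<Psi> x"
        using \<Psi> y by (auto simp: bij_betw_def)
      define f :: "'a \<Rightarrow> complex" where "f = (\<lambda>p. if p = y then 1 else 0)"
      have f\<Psi>: "a p * f (\<Psi> p) = (if p = x then a x else 0)" if "p \<in> space M" for p
        using that inv[of p] inv[of x] x by (auto simp: f_def)
      have f\<Psi>_zero: "a p * f (\<Psi> p) = 0" if "p \<in> space M" "p \<noteq> x" for p
        by (simp only: f\<Psi>[OF that(1)] that(2) if_False)
      have fL: "f \<in> L2_fun M"
        by (rule finite_support_L2, rule finite_subset[of _ "{y}"]) (auto simp: f_def)
      have afL: "(\<lambda>p. a p * f (\<Psi> p)) \<in> L2_fun M"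
      proof (rule finite_support_L2, rule finite_subset)
        show "{p \<in> space M. a p * f (\<Psi> p) \<noteq> 0} \<subseteq> {x}"
          using f\<Psi>_zero by blast
      qed simp
      have single: "(LINT p|M. c * indicator {q} p) = c * measure M {q}" if "q \<in> space M" for c :: complex and q
      proof -
        have "(LINT p|M. c * indicator {q} p) = (LINT p|M. indicator {q} p *\<^sub>R c)"
          by (intro Bochner_Integration.integral_cong refl) (simp split: split_indicator)
        also have "\<dots> = (LINT p|M. indicator {q} p) *\<^sub>R c"
          using that atom_finite[of q] by (intro integral_scaleR_left) (simp add: sets_eq_Pow less_top)
        also have "\<dots> = c * measure M {q}"
          using that by (simp add: scaleR_conv_of_real Int_absorb1)
        finally show ?thesis .
      qed
      have "cinner (L2 M) (L2_class M (\<lambda>p. a p * f (\<Psi> p))) v = cinner (L2 M) (L2_class M f) z"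
        using vz in_weighted_composition_opI[OF fL afL] unfolding adjoint_op_def by blast
      then have "(LINT p|M. (a p * f (\<Psi> p)) * cnj (g p)) = (LINT p|M. f p * cnj (h p))"
        by (simp only: g(2) h(2) cinner_L2 fL afL g(1) h(1))
      also have "(LINT p|M. (a p * f (\<Psi> p)) * cnj (g p)) = (LINT p|M. (a x * cnj (g x)) * indicator {x} p)"
        by (intro Bochner_Integration.integral_cong refl) (simp add: f\<Psi>)
      also have "(LINT p|M. f p * cnj (h p)) = (LINT p|M. cnj (h y) * indicator {y} p)"
        by (intro Bochner_Integration.integral_cong refl) (simp add: f_def)
      finally have "a x * cnj (g x) * measure M {x} = cnj (h y) * measure M {y}"
        using x \<open>y \<in> space M\<close> by (simp only: single)
      then have "cnj (a x * cnj (g x) * measure M {x}) = cnj (cnj (h y) * measure M {y})"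
        by (rule arg_cong)
      then have "h y * measure M {y} = (cnj (a x) * measure M {x}) * g x"
        by (simp add: mult_ac)
      also have "\<dots> = b y * g (\<Psi>' y) * measure M {y}"
        using b[OF x(1)] x inv[of x] by (simp add: mult_ac)
      finally show ?thesis using measure_atom_pos[OF y] by simp
    qed
    have L: "(\<lambda>x. b x * g (\<Psi>' x)) \<in> L2_fun M"
      using h(1) L2_fun_cong[of h "\<lambda>x. b x * g (\<Psi>' x)"] eq by simp
    then have "z = L2_class M (\<lambda>x. b x * g (\<Psi>' x))"
      using L2_class_eq_iff_all[OF h(1) L] eq h(2) by simp
    then show "(v, z) \<in> weighted_composition_op M b \<Psi>'"
      using in_weighted_composition_opI[OF g(1) L] g(2) by simp
  qed
qed

lemma dense_composition_op:
  assumes "\<phi> \<in> space M \<rightarrow> space M"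
    and "\<And>x. x \<in> space M \<Longrightarrow> emeasure M (\<phi> -` {x} \<inter> space M) < \<infinity>"
  shows "densely_defined (L2 M) (composition_op M \<phi>)"
proof (rule densely_defined_if_finite_support)
  show "Domain (composition_op M \<phi>) \<subseteq> vecs (L2 M)"
    by (auto simp: composition_op_def L2_class_in_vecs)
  fix f :: "'a \<Rightarrow> complex" assume fin: "finite {x \<in> space M. f x \<noteq> 0}"
  show "L2_class M f \<in> Domain (composition_op M \<phi>)"
    using comp_finite_support_L2[OF fin assms] finite_support_L2[OF fin]
    unfolding composition_op_def by blast
qed

text \<open>
  Let \<open>\<mu>\<close> be the mass of a point. The adjoint of the operator with symbol \<open>\<Psi>\<close> has weight \<open>w\<close> and
  symbol \<open>\<Psi>\<^sup>-\<^sup>1\<close>. As \<open>w\<close> is constant along the orbits of \<open>\<Psi>\<close>, both products of the operator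
  and its adjoint multiply by \<open>w\<close>. Their domains agree because membership of \<open>f\<close> in the domain of
  either factor amounts to the convergence of \<open>\<Sum> w \<mu> \<bar>f\<bar>\<^sup>2\<close>. The operator is closed since it is
  the adjoint of its adjoint.
\<close>

theorem normal_composition_op:
  assumes \<Psi>: "bij_betw \<Psi> (space M) (space M)"
    and w: "\<And>x. x \<in> space M \<Longrightarrow> w (\<Psi> x) * measure M {\<Psi> x} = measure M {x}"
    and w_inv: "\<And>x. x \<in> space M \<Longrightarrow> w (\<Psi> x) = w x"
  shows "normal_operator (L2 M) (composition_op M \<Psi>)"
proof -
  interpret H: complex_inner_space "L2 M" by (rule complex_inner_space_L2)
  define \<Psi>' where "\<Psi>' = the_inv_into (space M) \<Psi>"
  let ?N = "composition_op M \<Psi>"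
  let ?S = "weighted_composition_op M (\<lambda>x. complex_of_real (w x)) \<Psi>'"
  have \<Psi>_in: "\<Psi> \<in> space M \<rightarrow> space M" using \<Psi> by (auto simp: bij_betw_def)
  have inv: "\<Psi>' (\<Psi> x) = x" if "x \<in> space M" for x
    using \<Psi> that by (simp add: \<Psi>'_def bij_betw_def the_inv_into_f_f)
  have inv': "\<Psi> (\<Psi>' x) = x" if "x \<in> space M" for x
    using \<Psi> that by (simp add: \<Psi>'_def f_the_inv_into_f_bij_betw)
  have \<Psi>': "bij_betw \<Psi>' (space M) (space M)"
    unfolding \<Psi>'_def by (rule bij_betw_the_inv_into[OF \<Psi>])
  then have \<Psi>'_in: "\<Psi>' \<in> space M \<rightarrow> space M" by (auto simp: bij_betw_def)
  have adj_N: "adjoint_op (L2 M) ?N = ?S"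
    unfolding composition_op_eq_weighted
  proof (rule adjoint_weighted_composition_op[OF \<Psi> inv])
    fix x assume "x \<in> space M"
    from arg_cong[OF w[OF this], of complex_of_real]
    show "complex_of_real (w (\<Psi> x)) * measure M {\<Psi> x} = cnj 1 * measure M {x}" by simp
  qed
  have adj_S: "adjoint_op (L2 M) ?S = ?N"
    unfolding composition_op_eq_weighted
  proof (rule adjoint_weighted_composition_op[OF \<Psi>' inv'])
    fix x assume x: "x \<in> space M"
    then have x': "\<Psi>' x \<in> space M" using \<Psi>'_in by auto
    from w[OF x'] have "measure M {\<Psi>' x} = w x * measure M {x}" using x by (simp add: inv')
    then show "1 * complex_of_real (measure M {\<Psi>' x}) = cnj (complex_of_real (w x)) * measure M {x}"
      by simp
  qed
  \<comment> \<open>Both conditions say that the function \<open>?G\<close> below is summable.\<close>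
  have dom: "(\<lambda>x. f (\<Psi> x)) \<in> L2_fun M \<longleftrightarrow> (\<lambda>x. complex_of_real (w x) * f (\<Psi>' x)) \<in> L2_fun M" for f
  proof -
    let ?G = "\<lambda>y. w y * (measure M {y} * (cmod (f y))\<^sup>2)"
    let ?Q = "integrable (count_space (space M))"
    have "(\<lambda>x. f (\<Psi> x)) \<in> L2_fun M \<longleftrightarrow> ?Q (\<lambda>x. measure M {x} * (cmod (f (\<Psi> x)))\<^sup>2)"
      by (simp add: L2_fun_iff integrable_iff_count_space)
    also have "\<dots> \<longleftrightarrow> ?Q (\<lambda>x. ?G (\<Psi> x))"
      by (intro Bochner_Integration.integrable_cong refl) (simp add: w[symmetric])
    also have "\<dots> \<longleftrightarrow> ?Q ?G" by (rule integrable_bij_count_space[OF \<Psi>])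
    also have "\<dots> \<longleftrightarrow> ?Q (\<lambda>x. measure M {\<Psi> x} * (cmod (complex_of_real (w (\<Psi> x)) * f (\<Psi>' (\<Psi> x))))\<^sup>2)"
    proof (intro Bochner_Integration.integrable_cong refl)
      fix x assume x: "x \<in> space (count_space (space M))"
      then have "measure M {\<Psi> x} * (w x * w x) = w x * measure M {x}"
        using w[of x] w_inv[of x] x by (simp add: mult.commute)
      moreover have "(cmod (complex_of_real (w (\<Psi> x)) * f (\<Psi>' (\<Psi> x))))\<^sup>2 = (w x * w x) * (cmod (f x))\<^sup>2"
        using x by (simp add: inv w_inv norm_mult power_mult_distrib) (simp add: power2_eq_square)
      ultimately show "?G x = measure M {\<Psi> x} * (cmod (complex_of_real (w (\<Psi> x)) * f (\<Psi>' (\<Psi> x))))\<^sup>2"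
        by (metis mult.assoc)
    qed
    also have "\<dots> \<longleftrightarrow> ?Q (\<lambda>x. measure M {x} * (cmod (complex_of_real (w x) * f (\<Psi>' x)))\<^sup>2)"
      by (rule integrable_bij_count_space[OF \<Psi>, of "\<lambda>x. measure M {x} * (cmod (complex_of_real (w x) * f (\<Psi>' x)))\<^sup>2"])
    also have "\<dots> \<longleftrightarrow> (\<lambda>x. complex_of_real (w x) * f (\<Psi>' x)) \<in> L2_fun M"
      by (simp add: L2_fun_iff integrable_iff_count_space)
    finally show ?thesis .
  qed
  have "?N O ?S = {(L2_class M f, L2_class M (\<lambda>x. complex_of_real (w x) * (1 * f (\<Psi> (\<Psi>' x))))) | f.
      f \<in> L2_fun M \<and> (\<lambda>x. 1 * f (\<Psi> x)) \<in> L2_fun M \<and> (\<lambda>x. complex_of_real (w x) * (1 * f (\<Psi> (\<Psi>' x)))) \<in> L2_fun M}"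
    unfolding composition_op_eq_weighted by (rule relcomp_weighted_composition_op[OF \<Psi>'_in])
  also have "\<dots> = {(L2_class M f, L2_class M (\<lambda>x. 1 * (complex_of_real (w (\<Psi> x)) * f (\<Psi>' (\<Psi> x))))) | f.
      f \<in> L2_fun M \<and> (\<lambda>x. complex_of_real (w x) * f (\<Psi>' x)) \<in> L2_fun M \<and>
      (\<lambda>x. 1 * (complex_of_real (w (\<Psi> x)) * f (\<Psi>' (\<Psi> x)))) \<in> L2_fun M}"
  proof -
    have 1: "(\<lambda>x. complex_of_real (w x) * (1 * f (\<Psi> (\<Psi>' x)))) \<in> L2_fun M \<longleftrightarrow>
        (\<lambda>x. 1 * (complex_of_real (w (\<Psi> x)) * f (\<Psi>' (\<Psi> x)))) \<in> L2_fun M" for f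
      by (rule L2_fun_cong) (simp add: inv inv' w_inv)
    have 2: "L2_class M (\<lambda>x. complex_of_real (w x) * (1 * f (\<Psi> (\<Psi>' x)))) =
        L2_class M (\<lambda>x. 1 * (complex_of_real (w (\<Psi> x)) * f (\<Psi>' (\<Psi> x))))"
      if "(\<lambda>x. complex_of_real (w x) * (1 * f (\<Psi> (\<Psi>' x)))) \<in> L2_fun M" for f
      by (subst L2_class_eq_iff_all[OF that 1[THEN iffD1, OF that]]) (simp add: inv inv' w_inv)
    show ?thesis
      by (intro Collect_cong ex_cong1) (use 1 2 dom in \<open>auto simp only: mult_1_left\<close>)
  qed
  also have "\<dots> = ?S O ?N"
    unfolding composition_op_eq_weighted by (rule relcomp_weighted_composition_op[OF \<Psi>_in, symmetric])
  finally have comm: "?N O ?S = ?S O ?N" .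
  have "densely_defined (L2 M) ?N"
  proof (rule dense_composition_op[OF \<Psi>_in])
    fix x assume "x \<in> space M"
    moreover from this have "\<Psi> -` {x} \<inter> space M = {\<Psi>' x}"
      using inv inv' \<Psi>'_in by auto
    ultimately show "emeasure M (\<Psi> -` {x} \<inter> space M) < \<infinity>"
      using atom_finite[of "\<Psi>' x"] \<Psi>'_in by (auto simp: less_top)
  qed
  moreover have "closed_operator (L2 M) ?N"
    using H.closed_adjoint[OF weighted_composition_op_subset, of "\<lambda>x. complex_of_real (w x)" \<Psi>'] by (simp add: adj_S)
  moreover have "linear_operator (L2 M) ?N"
    unfolding composition_op_eq_weighted by (rule linear_weighted_composition_op[OF \<Psi>_in])
  ultimately show ?thesis
    unfolding normal_operator_def adj_N using comm by auto
qed

end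

section \<open>Domains of powers\<close>

context atomic_measure
begin

text \<open>
  The exponent is positive because the zeroth power of a graph is the identity on the whole type,
  not only on the vectors.
\<close>

lemma relpow_composition_op:
  assumes \<phi>: "\<phi> \<in> space M \<rightarrow> space M"
  shows "composition_op M \<phi> ^^ Suc k =
    {(L2_class M f, L2_class M (f \<circ> \<phi> ^^ Suc k)) | f. \<forall>j\<le>Suc k. f \<circ> \<phi> ^^ j \<in> L2_fun M}"
proof (induction k)
  case 0
  have base: "(\<forall>j\<le>Suc 0. f \<circ> \<phi> ^^ j \<in> L2_fun M) \<longleftrightarrow> f \<in> L2_fun M \<and> f \<circ> \<phi> \<in> L2_fun M" for f
    by (auto simp: le_Suc_eq)
  have one: "\<phi> ^^ Suc 0 = \<phi>" "R ^^ Suc 0 = R" for R :: "('b \<times> 'b) set"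
    by simp_all
  show ?case by (simp only: base one composition_op_def)
next
  case (Suc k)
  let ?C = "composition_op M \<phi>" and ?m = "Suc k"
  have step: "g \<circ> \<phi> = f \<circ> \<phi> ^^ Suc ?m" if "g = f \<circ> \<phi> ^^ ?m" for f g :: "'a \<Rightarrow> complex"
    using that by (simp only: funpow_Suc_right o_assoc)
  have "?C ^^ ?m O ?C =
      {(L2_class M f, L2_class M (f \<circ> \<phi> ^^ Suc ?m)) | f. \<forall>j\<le>Suc ?m. f \<circ> \<phi> ^^ j \<in> L2_fun M}" (is "?L = ?R")
  proof
    show "?L \<subseteq> ?R"
    proof (rule subrelI)
      fix u w assume "(u, w) \<in> ?L"
      then obtain v where uv: "(u, v) \<in> ?C ^^ ?m" and vw: "(v, w) \<in> ?C" by blast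
      obtain f where
        f: "\<forall>j\<le>?m. f \<circ> \<phi> ^^ j \<in> L2_fun M" "u = L2_class M f" "v = L2_class M (f \<circ> \<phi> ^^ ?m)"
        using uv unfolding Suc.IH by blast
      obtain g where
        g: "g \<in> L2_fun M" "g \<circ> \<phi> \<in> L2_fun M" "v = L2_class M g" "w = L2_class M (g \<circ> \<phi>)"
        using vw unfolding composition_op_def by blast
      let ?h = "f \<circ> \<phi> ^^ ?m"
      have fm: "?h \<in> L2_fun M" using f(1) by blast
      have "\<forall>x\<in>space M. g x = ?h x"
        using L2_class_eq_iff_all[OF g(1) fm] f(3) g(3) by simp
      then have eq: "(g \<circ> \<phi>) x = (?h \<circ> \<phi>) x" if "x \<in> space M" for x
        using \<phi> that by fastforce
      have L: "?h \<circ> \<phi> \<in> L2_fun M" by (rule iffD1[OF L2_fun_cong[OF eq] g(2)])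
      then have "w = L2_class M (?h \<circ> \<phi>)"
        unfolding g(4) L2_class_eq_iff_all[OF g(2) L] using eq by blast
      then have "w = L2_class M (f \<circ> \<phi> ^^ Suc ?m)" by (simp only: step)
      moreover have "\<forall>j\<le>Suc ?m. f \<circ> \<phi> ^^ j \<in> L2_fun M"
        using f(1) L by (metis le_Suc_eq step)
      ultimately show "(u, w) \<in> ?R" using f(2) by blast
    qed
    show "?R \<subseteq> ?L"
    proof (rule subrelI)
      fix u w assume "(u, w) \<in> ?R"
      then obtain f where f: "\<forall>j\<le>Suc ?m. f \<circ> \<phi> ^^ j \<in> L2_fun M" "u = L2_class M f"
          "w = L2_class M (f \<circ> \<phi> ^^ Suc ?m)"
        by blast
      let ?h = "f \<circ> \<phi> ^^ ?m"
      have "(u, L2_class M ?h) \<in> ?C ^^ ?m"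
        unfolding Suc.IH using f(1,2) by (auto intro!: exI[of _ f])
      moreover have "?h \<in> L2_fun M" "?h \<circ> \<phi> \<in> L2_fun M"
        using f(1) step[OF refl] by (metis le_Suc_eq order_refl)+
      then have "(L2_class M ?h, w) \<in> ?C"
        unfolding composition_op_def f(3) step[OF refl, symmetric] by blast
      ultimately show "(u, w) \<in> ?L" by blast
    qed
  qed
  then show ?case by (simp only: relpow.simps)
qed

lemma dense_relpow_composition_op:
  assumes \<phi>: "\<phi> \<in> space M \<rightarrow> space M"
    and fin: "\<And>x j. \<lbrakk>x \<in> space M; j \<le> Suc k\<rbrakk> \<Longrightarrow> emeasure M ((\<phi> ^^ j) -` {x} \<inter> space M) < \<infinity>"
  shows "densely_defined (L2 M) (composition_op M \<phi> ^^ Suc k)"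
proof (rule densely_defined_if_finite_support)
  have iter: "\<phi> ^^ j \<in> space M \<rightarrow> space M" for j
    using \<phi> by (induction j) auto
  show "Domain (composition_op M \<phi> ^^ Suc k) \<subseteq> vecs (L2 M)"
  proof
    fix u assume "u \<in> Domain (composition_op M \<phi> ^^ Suc k)"
    then obtain f where f: "u = L2_class M f" "\<forall>j\<le>Suc k. f \<circ> \<phi> ^^ j \<in> L2_fun M"
      unfolding relpow_composition_op[OF \<phi>] by blast
    from f(2)[rule_format, of 0] show "u \<in> vecs (L2 M)"
      by (simp add: f(1) L2_class_in_vecs)
  qed
  fix f :: "'a \<Rightarrow> complex" assume "finite {x \<in> space M. f x \<noteq> 0}"
  then have "\<forall>j\<le>Suc k. f \<circ> \<phi> ^^ j \<in> L2_fun M"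
    using comp_finite_support_L2[OF _ iter fin] by blast
  then show "L2_class M f \<in> Domain (composition_op M \<phi> ^^ Suc k)"
    unfolding relpow_composition_op[OF \<phi>] by blast
qed

text \<open>
  The function \<open>f \<circ> \<theta>\<close> is constant, with value \<open>f x\<close>, on a set of infinite measure.
\<close>

lemma vanishes_on_infinite_fibre:
  assumes L: "f \<circ> \<theta> \<in> L2_fun M" and inf: "emeasure M (\<theta> -` {x} \<inter> space M) = \<infinity>"
  shows "f x = 0"
proof (rule ccontr)
  assume nz: "f x \<noteq> 0"
  let ?A = "\<theta> -` {x} \<inter> space M"
  have "ennreal ((cmod (f x))\<^sup>2) * emeasure M ?A = (\<integral>\<^sup>+ y. ennreal ((cmod (f x))\<^sup>2) * indicator ?A y \<partial>M)"
    by (rule nn_integral_cmult_indicator[symmetric]) (simp add: sets_eq_Pow)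
  also have "\<dots> \<le> (\<integral>\<^sup>+ y. ennreal ((cmod ((f \<circ> \<theta>) y))\<^sup>2) \<partial>M)"
    by (intro nn_integral_mono) (auto split: split_indicator)
  also have "\<dots> < \<infinity>"
    using L by (simp add: L2_fun_iff integrable_iff_bounded)
  finally show False using inf nz by (simp add: ennreal_mult_top)
qed

lemma trivial_domain_relpow:
  assumes \<phi>: "\<phi> \<in> space M \<rightarrow> space M"
    and inf: "\<And>x. x \<in> space M \<Longrightarrow> emeasure M ((\<phi> ^^ Suc k) -` {x} \<inter> space M) = \<infinity>"
  shows "Domain (composition_op M \<phi> ^^ Suc k) = {vzero (L2 M)}"
proof
  show "Domain (composition_op M \<phi> ^^ Suc k) \<subseteq> {vzero (L2 M)}"
  proof
    fix u assume "u \<in> Domain (composition_op M \<phi> ^^ Suc k)"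
    then obtain f where f: "u = L2_class M f" "\<forall>j\<le>Suc k. f \<circ> \<phi> ^^ j \<in> L2_fun M"
      unfolding relpow_composition_op[OF \<phi>] by blast
    have "f \<in> L2_fun M" using f(2)[rule_format, of 0] by simp
    moreover have "\<forall>x\<in>space M. f x = 0"
      using vanishes_on_infinite_fibre[OF f(2)[rule_format, OF order_refl] inf] by blast
    ultimately show "u \<in> {vzero (L2 M)}"
      by (simp add: f(1) vzero_L2 L2_class_eq_iff_all L2_fun_zero)
  qed
  have "(\<lambda>_. 0) \<circ> \<phi> ^^ j \<in> L2_fun M" for j using L2_fun_zero by (simp add: o_def)
  then show "{vzero (L2 M)} \<subseteq> Domain (composition_op M \<phi> ^^ Suc k)"
    unfolding relpow_composition_op[OF \<phi>] vzero_L2 by blast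
qed

lemma nontrivial_L2:
  assumes "space M \<noteq> {}"
  shows "vecs (L2 M) \<noteq> {vzero (L2 M)}"
proof -
  obtain x where x: "x \<in> space M" using assms by auto
  let ?f = "\<lambda>y. if y = x then 1 else 0 :: complex"
  have f: "?f \<in> L2_fun M"
    by (rule finite_support_L2, rule finite_subset[of _ "{x}"]) auto
  show ?thesis
  proof
    assume "vecs (L2 M) = {vzero (L2 M)}"
    then have "L2_class M ?f = L2_class M (\<lambda>_. 0)"
      using L2_class_in_vecs[OF f] by (simp add: vzero_L2)
    then have "?f x = 0" using x unfolding L2_class_eq_iff_all[OF f L2_fun_zero] by blast
    then show False by simp
  qed
qed

end

section \<open>Factor maps and subnormality\<close>

lemma composition_with_factor_map:
  assumes \<pi>: "\<pi> \<in> measurable N M" and M: "M = distr N M \<pi>"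
  shows "f \<in> L2_fun M \<Longrightarrow> f \<circ> \<pi> \<in> L2_fun N"
    and "\<lbrakk>f \<in> L2_fun M; g \<in> L2_fun M\<rbrakk> \<Longrightarrow>
      (LINT y|N. f (\<pi> y) * cnj (g (\<pi> y))) = (LINT x|M. f x * cnj (g x))"
    and "AE x in M. f x = g x \<Longrightarrow> AE y in N. f (\<pi> y) = g (\<pi> y)"
proof -
  show "f \<circ> \<pi> \<in> L2_fun N" if "f \<in> L2_fun M"
  proof -
    have fm: "f \<in> borel_measurable M" using that by (simp add: L2_fun_def)
    have "integrable (distr N M \<pi>) (\<lambda>x. (cmod (f x))\<^sup>2)"
      using that unfolding M[symmetric] by (simp add: L2_fun_def)
    then have "integrable N (\<lambda>y. (cmod (f (\<pi> y)))\<^sup>2)"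
      using fm by (subst (asm) integrable_distr_eq[OF \<pi>]) auto
    then show ?thesis using measurable_comp[OF \<pi> fm] by (simp add: L2_fun_def o_def)
  qed
  show "(LINT y|N. f (\<pi> y) * cnj (g (\<pi> y))) = (LINT x|M. f x * cnj (g x))"
    if "f \<in> L2_fun M" "g \<in> L2_fun M"
  proof -
    have m: "(\<lambda>x. f x * cnj (g x)) \<in> borel_measurable M"
      using L2_fun_integrable_mult[OF that] by auto
    have "(LINT y|N. f (\<pi> y) * cnj (g (\<pi> y))) = (LINT x|distr N M \<pi>. f x * cnj (g x))"
      using integral_distr[OF \<pi> m] by simp
    then show ?thesis by (simp only: M[symmetric])
  qed
  show "AE y in N. f (\<pi> y) = g (\<pi> y)" if "AE x in M. f x = g x"
  proof -
    have "AE x in distr N M \<pi>. f x = g x" using that by (simp only: M[symmetric])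
    then show ?thesis by (rule AE_distrD[OF \<pi>])
  qed
qed

lemma isometric_embedding_factor_map:
  assumes \<pi>: "\<pi> \<in> measurable N M" and M: "M = distr N M \<pi>"
  obtains V where "isometric_embedding (L2 M) (L2 N) V"
    and "\<And>f. f \<in> L2_fun M \<Longrightarrow> V (L2_class M f) = L2_class N (f \<circ> \<pi>)"
proof -
  define V where "V u = L2_class N ((SOME f. f \<in> L2_fun M \<and> u = L2_class M f) \<circ> \<pi>)" for u
  note fac = composition_with_factor_map[OF \<pi> M]
  have V: "V (L2_class M f) = L2_class N (f \<circ> \<pi>)" if f: "f \<in> L2_fun M" for f
  proof -
    define g where "g = (SOME g. g \<in> L2_fun M \<and> L2_class M f = L2_class M g)"
    have g: "g \<in> L2_fun M \<and> L2_class M f = L2_class M g"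
      unfolding g_def by (rule someI[of _ f]) (simp add: f)
    then have "AE x in M. g x = f x" using f L2_class_eq_iff[of g M f] by simp
    then have "L2_class N (g \<circ> \<pi>) = L2_class N (f \<circ> \<pi>)"
      using fac(3)[of g f] f g by (subst L2_class_eq_iff) (auto intro: fac(1))
    then show ?thesis by (simp add: V_def g_def)
  qed
  have "isometric_embedding (L2 M) (L2 N) V"
    unfolding isometric_embedding_def
  proof (intro conjI ballI allI)
    show "V \<in> vecs (L2 M) \<rightarrow> vecs (L2 N)"
      by (auto elim!: vecs_L2E simp: V intro!: L2_class_in_vecs fac(1))
  next
    fix u v assume "u \<in> vecs (L2 M)" "v \<in> vecs (L2 M)"
    then obtain f g where f: "f \<in> L2_fun M" "u = L2_class M f" and g: "g \<in> L2_fun M" "v = L2_class M g"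
      by (meson vecs_L2E)
    show "V (vadd (L2 M) u v) = vadd (L2 N) (V u) (V v)"
      by (simp only: f(2) g(2) V vadd_L2 f(1) g(1) L2_fun_add fac(1)) (simp add: o_def)
    show "cinner (L2 N) (V u) (V v) = cinner (L2 M) u v"
      by (simp only: f(2) g(2) V cinner_L2 f(1) g(1) fac(1)) (simp add: fac(2) f g)
  next
    fix a u assume "u \<in> vecs (L2 M)"
    then obtain f where f: "f \<in> L2_fun M" "u = L2_class M f" by (meson vecs_L2E)
    show "V (vscale (L2 M) a u) = vscale (L2 N) a (V u)"
      by (simp only: f(2) V vscale_L2 f(1) L2_fun_scale fac(1)) (simp add: o_def)
  qed
  then show ?thesis using V that by blast
qed

text \<open>
  The embedding \<open>f \<mapsto> f \<circ> \<pi>\<close> carries \<open>f \<circ> \<phi>\<close> to \<open>f \<circ> \<phi> \<circ> \<pi> = (f \<circ> \<pi>) \<circ> \<Psi>\<close>, so composition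
  with the lift \<open>\<Psi>\<close> extends composition with \<open>\<phi>\<close>.
\<close>

theorem subnormal_composition_op_if_normal_lift:
  fixes M N :: "'a measure"
  assumes M: "atomic_measure M" and N: "atomic_measure N"
    and \<pi>: "\<pi> \<in> measurable N M" and image: "M = distr N M \<pi>"
    and \<phi>: "\<phi> \<in> space M \<rightarrow> space M"
    and lift: "\<And>y. y \<in> space N \<Longrightarrow> \<pi> (\<Psi> y) = \<phi> (\<pi> y)"
    and normal: "normal_operator (L2 N) (composition_op N \<Psi>)"
    and dense: "densely_defined (L2 M) (composition_op M \<phi>)"
  shows "subnormal (L2 M) (composition_op M \<phi>)"
proof -
  interpret M: atomic_measure M by (rule M)
  interpret N: atomic_measure N by (rule N)
  obtain V where V: "isometric_embedding (L2 M) (L2 N) V"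
    and V_class: "\<And>f. f \<in> L2_fun M \<Longrightarrow> V (L2_class M f) = L2_class N (f \<circ> \<pi>)"
    using isometric_embedding_factor_map[OF \<pi> image] by blast
  have ext: "(V u, V v) \<in> composition_op N \<Psi>" if uv: "(u, v) \<in> composition_op M \<phi>" for u v
  proof -
    obtain f where f: "f \<in> L2_fun M" "f \<circ> \<phi> \<in> L2_fun M" "u = L2_class M f" "v = L2_class M (f \<circ> \<phi>)"
      using uv by (auto simp: composition_op_def)
    have eq: "(f \<circ> \<phi> \<circ> \<pi>) y = (f \<circ> \<pi> \<circ> \<Psi>) y" if "y \<in> space N" for y
      using lift[OF that] by simp
    have L: "f \<circ> \<pi> \<in> L2_fun N" "f \<circ> \<phi> \<circ> \<pi> \<in> L2_fun N"
      using composition_with_factor_map(1)[OF \<pi> image] f(1,2) by auto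
    have L': "f \<circ> \<pi> \<circ> \<Psi> \<in> L2_fun N"
      by (intro iffD1[OF N.L2_fun_cong[OF eq] L(2)])
    then have "V v = L2_class N (f \<circ> \<pi> \<circ> \<Psi>)"
      unfolding f(4) V_class[OF f(2)] N.L2_class_eq_iff_all[OF L(2) L'] using eq by blast
    then show ?thesis
      unfolding f(3) V_class[OF f(1)] composition_op_def using L(1) L' by blast
  qed
  have "linear_operator (L2 M) (composition_op M \<phi>)"
    unfolding composition_op_eq_weighted by (rule M.linear_weighted_composition_op[OF \<phi>])
  then show ?thesis
    unfolding subnormal_def using dense N.hilbert_space_L2 V normal ext by blast
qed

section \<open>Branches and their masses\<close>

text \<open>
  An entry \<open>(k, i)\<close> of a branch records that the branch takes the turn number \<open>i\<close> on its way
  from height \<open>k\<close> to height \<open>k + 1\<close>; without such an entry it goes straight on. Only the part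
  of a branch below height \<open>k\<close>, its truncation, can be seen at height \<open>k\<close>. Lists in
  any order serve as branches, since only the compatibility of truncations at different heights
  matters.
\<close>

type_synonym branch = "(int \<times> nat) list"

definition truncate :: "int \<Rightarrow> branch \<Rightarrow> branch" where
  "truncate k b = filter (\<lambda>e. fst e < k) b"

text \<open>
  The least height from which on the whole branch can be seen. The level of the empty branch is an
  unspecified number, which does no harm: at every height the empty branch is its own truncation,
  and a single branch never decides whether the masses in a cell have a finite sum.
\<close>

definition level :: "branch \<Rightarrow> int" where
  "level b = Max (fst ` set b) + 1"

text \<open>
  The numbering of the branches makes the reciprocals of the ratios summable.
\<close>

definition ratio :: "branch \<Rightarrow> real" where
  "ratio b = 2 ^ Suc (to_nat b)"

text \<open>
  For a fixed branch the masses grow geometrically with the height, so lowering the height divides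
  the mass by a constant. The shift of the exponent by the level puts the first infinite sum over
  a cell exactly \<open>n + 1\<close> heights above the cell.
\<close>

definition mass :: "nat \<Rightarrow> int \<times> branch \<Rightarrow> real" where
  "mass n = (\<lambda>(k, b). ratio b powi (k - int n - level b))"

lemma truncate_truncate [simp]: "k \<le> l \<Longrightarrow> truncate k (truncate l b) = truncate k b"
  unfolding truncate_def filter_filter by (intro filter_cong) auto

lemma ratio_pos: "0 < ratio b"
  by (simp add: ratio_def)

lemma mass_pos: "0 < mass n y"
  by (simp add: mass_def ratio_pos split: prod.split)

lemma ratio_times_mass: "ratio b * mass n (k - 1, b) = mass n (k, b)"
  using power_int_add_1'[of "ratio b" "k - 1 - int n - level b"] ratio_pos[of b]
  by (simp add: mass_def algebra_simps)

lemma level_gt_if_truncate_neq: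
  assumes "truncate k b \<noteq> b"
  shows "k < level b"
proof -
  obtain e where e: "e \<in> set b" "k \<le> fst e"
    using assms by (auto simp: truncate_def filter_id_conv not_less)
  then have "fst e \<le> Max (fst ` set b)" by (intro Max_ge) auto
  then show ?thesis unfolding level_def using e(2) by linarith
qed

lemma level_append:
  assumes "truncate k p = p"
  shows "level (p @ [(k, i)]) = k + 1"
proof -
  have "\<forall>e\<in>set p. fst e < k" using assms by (simp add: truncate_def filter_id_conv)
  then have "Max (fst ` set (p @ [(k, i)])) = k"
    by (intro Max_eqI) (auto intro: less_imp_le)
  then show ?thesis by (simp add: level_def)
qed

text \<open>
  The sum over all branches is a part of the geometric series.
\<close>

lemma nn_integral_half_pow_finite:
  "(\<integral>\<^sup>+ b. ennreal ((1/2) ^ to_nat (b :: branch)) \<partial>count_space UNIV) < \<infinity>"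
proof -
  have "bij_betw to_nat (UNIV :: branch set) (range (to_nat :: branch \<Rightarrow> nat))"
    by (simp add: bij_betw_def)
  from nn_integral_bij_count_space[OF this, of "\<lambda>i. ennreal ((1/2) ^ i)"]
  have "(\<integral>\<^sup>+ b. ennreal ((1/2) ^ to_nat (b :: branch)) \<partial>count_space UNIV)
      = (\<integral>\<^sup>+ i. ennreal ((1/2) ^ i) \<partial>count_space (range (to_nat :: branch \<Rightarrow> nat)))" .
  also have "\<dots> = (\<integral>\<^sup>+ i. ennreal ((1/2) ^ i) * indicator (range (to_nat :: branch \<Rightarrow> nat)) i \<partial>count_space UNIV)"
    by (rule nn_integral_count_space_indicator) simp
  also have "\<dots> \<le> (\<integral>\<^sup>+ i. ennreal ((1/2) ^ i) \<partial>count_space UNIV)"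
    by (intro nn_integral_mono) (auto split: split_indicator)
  also have "\<dots> = (\<Sum>i. ennreal ((1/2) ^ i))"
    by (rule nn_integral_count_space_nat)
  also have "\<dots> = ennreal (\<Sum>i. (1/2) ^ i)"
    by (intro suminf_ennreal2 summable_geometric) auto
  also have "\<dots> < \<infinity>" by simp
  finally show ?thesis .
qed

text \<open>
  All branches in the cell except \<open>p\<close> itself have a turn at height \<open>k\<close> or above, hence a level
  above \<open>k\<close>. For \<open>j \<le> n\<close> the exponent of their mass is then negative, and their masses are at
  most the summable reciprocals of the ratios.
\<close>

lemma cell_mass_finite:
  assumes "j \<le> n"
  shows "(\<integral>\<^sup>+ b. ennreal (mass n (k + int j, b)) \<partial>count_space {b. truncate k b = p}) < \<infinity>"
proof -
  let ?c = "mass n (k + int j, p)"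
  have le: "mass n (k + int j, b) \<le> (1/2) ^ to_nat b" if b: "truncate k b = p" "b \<noteq> p" for b
  proof -
    have "k < level b" using b level_gt_if_truncate_neq by auto
    then have "k + int j - int n - level b \<le> - 1" using assms by linarith
    moreover have "1 \<le> ratio b" by (simp only: ratio_def one_le_power one_le_numeral)
    ultimately have "mass n (k + int j, b) \<le> ratio b powi (- 1)"
      by (simp only: mass_def prod.case power_int_increasing)
    also have "\<dots> = (1/2) ^ Suc (to_nat b)"
      by (simp add: ratio_def power_int_minus field_simps)
    also have "\<dots> \<le> (1/2) ^ to_nat b" by simp
    finally show ?thesis .
  qed
  have "(\<integral>\<^sup>+ b. ennreal (mass n (k + int j, b)) \<partial>count_space {b. truncate k b = p})
      = (\<integral>\<^sup>+ b. ennreal (mass n (k + int j, b)) * indicator {b. truncate k b = p} b \<partial>count_space UNIV)"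
    by (rule nn_integral_count_space_indicator) simp
  also have "\<dots> \<le> (\<integral>\<^sup>+ b. ennreal ?c * indicator {p} b + ennreal ((1/2) ^ to_nat b) \<partial>count_space UNIV)"
    by (intro nn_integral_mono) (auto split: split_indicator simp: le ennreal_leI)
  also have "\<dots> = (\<integral>\<^sup>+ b. ennreal ?c * indicator {p} b \<partial>count_space UNIV)
      + (\<integral>\<^sup>+ b. ennreal ((1/2) ^ to_nat (b :: branch)) \<partial>count_space UNIV)"
    by (rule nn_integral_add) auto
  also have "(\<integral>\<^sup>+ b. ennreal ?c * indicator {p} b \<partial>count_space UNIV) = ennreal ?c"
    by simp
  also have "ennreal ?c + (\<integral>\<^sup>+ b. ennreal ((1/2) ^ to_nat (b :: branch)) \<partial>count_space UNIV) < \<infinity>"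
    using nn_integral_half_pow_finite by (simp add: less_top[symmetric])
  finally show ?thesis .
qed

text \<open>
  The branches that follow \<open>p\<close> and take one last turn at height \<open>k\<close> have level \<open>k + 1\<close>. At
  height \<open>k + n + 1\<close> the exponent of their mass is zero, so each of these infinitely many branches
  contributes \<open>1\<close>.
\<close>

lemma cell_mass_infinite:
  assumes p: "truncate k p = p"
  shows "(\<integral>\<^sup>+ b. ennreal (mass n (k + int (Suc n), b)) \<partial>count_space {b. truncate k b = p}) = \<infinity>"
proof -
  let ?I = "range (\<lambda>i. p @ [(k, i)])"
  have I: "?I \<subseteq> {b. truncate k b = p}" using p by (auto simp: truncate_def)
  have "infinite ?I" by (rule range_inj_infinite) (simp add: inj_def)
  then have "\<infinity> = emeasure (count_space {b. truncate k b = p}) ?I"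
    using I by simp
  also have "\<dots> = (\<integral>\<^sup>+ b. indicator ?I b \<partial>count_space {b. truncate k b = p})"
    using I by simp
  also have "\<dots> \<le> (\<integral>\<^sup>+ b. ennreal (mass n (k + int (Suc n), b)) \<partial>count_space {b. truncate k b = p})"
  proof (rule nn_integral_mono)
    fix b
    have "mass n (k + int (Suc n), b) = 1" if "b \<in> ?I"
      using that by (auto simp: mass_def level_append[OF p])
    then show "indicator ?I b \<le> ennreal (mass n (k + int (Suc n), b))"
      by (cases "b \<in> ?I") simp_all
  qed
  finally show ?thesis by (simp add: top_unique)
qed

section \<open>The tree, its parent map and its lift to branches\<close>

text \<open>
  Pairs of a height and a branch become real numbers, as the points of the measure space have
  to be.
\<close>

definition code :: "int \<times> branch \<Rightarrow> real" where
  "code y = real (to_nat y)"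

abbreviation decode :: "real \<Rightarrow> int \<times> branch" where
  "decode \<equiv> inv code"

lemma inj_code: "inj code"
  by (auto simp: inj_def code_def)

lemma decode_code [simp]: "decode (code y) = y"
  by (simp add: inj_code)

lemma code_eq_iff [simp]: "code y = code z \<longleftrightarrow> y = z"
  by (rule inj_eq[OF inj_code])

definition project :: "real \<Rightarrow> real" where
  "project x = (case decode x of (k, b) \<Rightarrow> code (k, truncate k b))"

definition shift :: "real \<Rightarrow> real" where
  "shift x = (case decode x of (k, b) \<Rightarrow> code (k - 1, b))"

definition branch_measure :: "nat \<Rightarrow> real measure" where
  "branch_measure n = density (count_space (range code)) (\<lambda>x. ennreal (mass n (decode x)))"

text \<open>
  A vertex at height \<open>k\<close> is a truncated branch, and its mass is the total mass at height \<open>k\<close> of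
  the branches that run through it.
\<close>

definition tree_measure :: "nat \<Rightarrow> real measure" where
  "tree_measure n = distr (branch_measure n) (count_space (range (project \<circ> code))) project"

definition parent :: "real \<Rightarrow> real" where
  "parent x = project (shift x)"

lemma project_code [simp]: "project (code (k, b)) = code (k, truncate k b)"
  by (simp add: project_def)

lemma shift_code [simp]: "shift (code (k, b)) = code (k - 1, b)"
  by (simp add: shift_def)

lemma space_branch_measure [simp]: "space (branch_measure n) = range code"
  by (simp add: branch_measure_def)

lemma sets_branch_measure [simp]: "sets (branch_measure n) = Pow (range code)"
  by (simp add: branch_measure_def)

lemma space_tree_measure [simp]: "space (tree_measure n) = range (project \<circ> code)"
  by (simp add: tree_measure_def)

lemma sets_tree_measure [simp]: "sets (tree_measure n) = Pow (range (project \<circ> code))"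
  by (simp add: tree_measure_def)

lemma in_space_treeE:
  assumes "x \<in> space (tree_measure n)"
  obtains k p where "x = code (k, p)" "truncate k p = p"
proof -
  obtain y where "x = project (code y)" using assms by auto
  then show ?thesis by (cases y) (auto intro!: that)
qed

lemma emeasure_branch_measure:
  "emeasure (branch_measure n) (code ` A) = (\<integral>\<^sup>+ y. ennreal (mass n y) \<partial>count_space A)"
proof -
  have "emeasure (branch_measure n) (code ` A)
      = (\<integral>\<^sup>+ x. ennreal (mass n (decode x)) * indicator (code ` A) x \<partial>count_space (range code))"
    unfolding branch_measure_def by (rule emeasure_density) auto
  also have "\<dots> = (\<integral>\<^sup>+ y. ennreal (mass n (decode (code y))) * indicator (code ` A) (code y) \<partial>count_space UNIV)"
    by (rule nn_integral_bij_count_space[symmetric]) (simp add: bij_betw_def inj_code)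
  also have "\<dots> = (\<integral>\<^sup>+ y. ennreal (mass n y) * indicator A y \<partial>count_space UNIV)"
    by (intro nn_integral_cong) (auto split: split_indicator)
  also have "\<dots> = (\<integral>\<^sup>+ y. ennreal (mass n y) \<partial>count_space A)"
    by (rule nn_integral_count_space_indicator[symmetric]) simp
  finally show ?thesis .
qed

lemma emeasure_branch_atom: "emeasure (branch_measure n) {code y} = ennreal (mass n y)"
  using emeasure_branch_measure[of n "{y}"] by (simp add: nn_integral_count_space_finite)

interpretation branch: atomic_measure "branch_measure n" for n
proof
  show "countable (space (branch_measure n))"
    by simp
  fix x assume "x \<in> space (branch_measure n)"
  then obtain y where x: "x = code y" by auto
  show "emeasure (branch_measure n) {x} \<noteq> 0" "emeasure (branch_measure n) {x} \<noteq> \<infinity>"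
    unfolding x emeasure_branch_atom using mass_pos[of n y] by auto
qed simp

lemma shift_bij: "bij_betw shift (range code) (range code)"
  unfolding bij_betw_def
proof
  show "inj_on shift (range code)" by (auto simp: inj_on_def)
  show "shift ` range code = range code"
  proof
    show "range code \<subseteq> shift ` range code"
    proof
      fix x assume "x \<in> range code"
      then obtain k b where "x = code (k, b)" by auto
      then have "x = shift (code (k + 1, b))" by simp
      then show "x \<in> shift ` range code" by blast
    qed
  qed auto
qed

text \<open>
  The weight is the ratio of the branch: moving along a branch does not change it.
\<close>

lemma normal_shift: "normal_operator (L2 (branch_measure n)) (composition_op (branch_measure n) shift)"
proof (rule branch.normal_composition_op[where w = "\<lambda>x. ratio (snd (decode x))"])
  show "bij_betw shift (space (branch_measure n)) (space (branch_measure n))"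
    by (simp add: shift_bij)
  fix x assume "x \<in> space (branch_measure n)"
  then obtain k b where x: "x = code (k, b)" by auto
  show "ratio (snd (decode (shift x))) * measure (branch_measure n) {shift x} = measure (branch_measure n) {x}"
    using mass_pos[THEN less_imp_le]
    by (simp add: x measure_def emeasure_branch_atom ratio_times_mass)
  show "ratio (snd (decode (shift x))) = ratio (snd (decode x))"
    by (simp add: x)
qed

lemma iterate_parent: "(parent ^^ j) (code (k, truncate k b)) = code (k - int j, truncate (k - int j) b)"
  by (induction j) (auto simp: parent_def algebra_simps)

lemma project_measurable: "project \<in> measurable (branch_measure n) (tree_measure n)"
  by (rule branch.measurable_any) auto

lemma tree_measure_eq_distr: "tree_measure n = distr (branch_measure n) (tree_measure n) project"
  by (rule measure_eqI) (auto simp: tree_measure_def intro!: arg_cong2[where f = emeasure] distr_cong)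

lemma parent_in_space: "parent \<in> space (tree_measure n) \<rightarrow> space (tree_measure n)"
  by (auto simp: parent_def image_iff)

text \<open>
  The descendants of a vertex in the \<open>j\<close>-th generation are reached by exactly those branches that
  run through the vertex, and these have to be weighed at height \<open>k + j\<close>.
\<close>

lemma emeasure_parent_vimage:
  assumes p: "truncate k p = p"
  shows "emeasure (tree_measure n) ((parent ^^ j) -` {code (k, p)} \<inter> space (tree_measure n))
    = (\<integral>\<^sup>+ b. ennreal (mass n (k + int j, b)) \<partial>count_space {b. truncate k b = p})"
proof -
  let ?A = "(parent ^^ j) -` {code (k, p)} \<inter> space (tree_measure n)"
  have "emeasure (tree_measure n) ?A = emeasure (branch_measure n) (project -` ?A \<inter> space (branch_measure n))"
    by (subst tree_measure_eq_distr, rule emeasure_distr[OF project_measurable]) auto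
  also have "project -` ?A \<inter> space (branch_measure n) = code ` (Pair (k + int j) ` {b. truncate k b = p})"
    by (auto simp: iterate_parent image_iff)
  also have "emeasure (branch_measure n) \<dots> = (\<integral>\<^sup>+ y. ennreal (mass n y) \<partial>count_space (Pair (k + int j) ` {b. truncate k b = p}))"
    by (rule emeasure_branch_measure)
  also have "\<dots> = (\<integral>\<^sup>+ b. ennreal (mass n (k + int j, b)) \<partial>count_space {b. truncate k b = p})"
    by (rule nn_integral_bij_count_space[symmetric]) (simp add: bij_betw_def inj_on_def)
  finally show ?thesis .
qed

lemma fibre_finite:
  assumes "x \<in> space (tree_measure n)" "j \<le> n"
  shows "emeasure (tree_measure n) ((parent ^^ j) -` {x} \<inter> space (tree_measure n)) < \<infinity>"
  using assms by (auto elim!: in_space_treeE simp only: emeasure_parent_vimage cell_mass_finite)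

lemma fibre_infinite:
  assumes "x \<in> space (tree_measure n)"
  shows "emeasure (tree_measure n) ((parent ^^ Suc n) -` {x} \<inter> space (tree_measure n)) = \<infinity>"
  using assms by (auto elim!: in_space_treeE simp only: emeasure_parent_vimage cell_mass_infinite)

interpretation tree: atomic_measure "tree_measure n" for n
proof
  show "countable (space (tree_measure n))"
    by simp
  fix x assume x: "x \<in> space (tree_measure n)"
  show "emeasure (tree_measure n) {x} \<noteq> \<infinity>"
    using fibre_finite[OF x, of 0] x by (simp add: Int_absorb1)
  obtain y where y: "x = project (code y)" using x by auto
  have "0 < emeasure (branch_measure n) {code y}"
    by (simp add: emeasure_branch_atom mass_pos)
  also have "\<dots> \<le> emeasure (branch_measure n) (project -` {x} \<inter> space (branch_measure n))"
    using y by (intro emeasure_mono) auto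
  also have "\<dots> = emeasure (tree_measure n) {x}"
    using x by (subst tree_measure_eq_distr, subst emeasure_distr[OF project_measurable]) auto
  finally show "emeasure (tree_measure n) {x} \<noteq> 0" by simp
qed simp

theorem corollary3p4:
  fixes n :: nat
  assumes "n \<ge> 1"
  shows "\<exists>(M :: real measure) \<phi>.
    sigma_finite_measure M \<and> nonsingular_map M \<phi> \<and>
    vecs (L2 M) \<noteq> {vzero (L2 M)} \<and>
    subnormal (L2 M) (composition_op M \<phi>) \<and>
    densely_defined (L2 M) (composition_op M \<phi> ^^ n) \<and>
    Domain (composition_op M \<phi> ^^ (n + 1)) = {vzero (L2 M)}"
proof -
  let ?M = "tree_measure n" and ?C = "composition_op (tree_measure n) parent"
  obtain m where m: "n = Suc m" using assms by (cases n) auto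
  have dense: "densely_defined (L2 ?M) ?C"
    using fibre_finite[where j = 1] assms
    by (intro tree.dense_composition_op parent_in_space) auto
  have "subnormal (L2 ?M) ?C"
  proof (rule subnormal_composition_op_if_normal_lift[OF tree.atomic_measure_axioms branch.atomic_measure_axioms
        project_measurable tree_measure_eq_distr parent_in_space _ normal_shift dense])
    fix y assume "y \<in> space (branch_measure n)"
    then show "project (shift y) = parent (project y)"
      by (auto simp: parent_def)
  qed
  moreover have "densely_defined (L2 ?M) (?C ^^ n)"
    unfolding m by (rule tree.dense_relpow_composition_op[OF parent_in_space]) (use fibre_finite m in auto)
  moreover have "Domain (?C ^^ (n + 1)) = {vzero (L2 ?M)}"
    using tree.trivial_domain_relpow[OF parent_in_space fibre_infinite] by simp
  moreover have "vecs (L2 ?M) \<noteq> {vzero (L2 ?M)}"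
    by (rule tree.nontrivial_L2) simp
  ultimately show ?thesis
    using tree.sigma_finite tree.nonsingular[OF parent_in_space] by blast
qed

end
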